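(* Let $(M,g)$ be an $n$-dimensional ($n>3$) weakly $Z$ symmetric manifold $(WZS)_n$ which is also a generalized Ricci pseudosymmetric manifold in the sense of R. Deszcz, with associated scalar function $L_S$. If the $Z$ tensor is non singular and $L_S\neq-\frac13$, then $\omega_k=A_k-B_k$ is a closed 1-form.
   Context: $(M,g)$ is an $n$-dimensional Riemannian manifold with Levi-Civita connection $\nabla$; index notation with summation over repeated indices; $R_{jkl}{}^m$ is the Riemann tensor, with sign convention $(\nabla_i\nabla_k-\nabla_k\nabla_i)v_l=R_{ikl}{}^mv_m$ for covectors $v$; $R_{jklm}=R_{jkl}{}^sg_{sm}$, $R_{kl}=-R_{mkl}{}^m$ is the Ricci tensor, $R=g^{ij}R_{ij}$ the scalar curvature. Generalized $Z$ tensor: $Z_{kl}=R_{kl}+\phi\,g_{kl}$, where $\phi$ is an arbitrary scalar function. The manifold is weakly $Z$ symmetric, $(WZS)_n$, if for some $\phi$ there are covectors $A_k,B_k,D_k$ with $$\nabla_kZ_{jl}=A_kZ_{jl}+B_jZ_{kl}+D_lZ_{kj}.$$ The $Z$ tensor is non singular if there is a $(2,0)$ tensor $Z^{-1}$ with $(Z^{-1})^{kh}Z_{kl}=\delta^h{}_l$. A 1-form $\omega_k$ is closed if $\nabla_i\omega_j-\nabla_j\omega_i=0$. A Riemannian manifold is generalized Ricci pseudosymmetric in the sense of R. Deszcz if $$(\nabla_s\nabla_i-\nabla_i\nabla_s)R_{jklm}=L_S\,(R_{js}R_{iklm}-R_{ji}R_{sklm}+R_{ks}R_{jilm}-R_{ki}R_{jslm}+R_{ls}R_{jkim}-R_{li}R_{jksm}+R_{ms}R_{jkli}-R_{mi}R_{jkls}),$$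 where $L_S$ is a non null scalar function. *)

theory Defs
  imports "HOL-Analysis.Analysis"
begin

section \<open>Smooth functions on open subsets of Euclidean space\<close>

definition pd :: "'n::finite \<Rightarrow> (real^'n \<Rightarrow> real) \<Rightarrow> real^'n \<Rightarrow> real" where
  "pd i f x = frechet_derivative f (at x) (axis i 1)"

primrec Ck_on :: "nat \<Rightarrow> (real^'n \<Rightarrow> real) \<Rightarrow> (real^'n) set \<Rightarrow> bool" where
  "Ck_on 0 f S \<longleftrightarrow> continuous_on S f"
| "Ck_on (Suc k) f S \<longleftrightarrow> (\<forall>x\<in>S. f differentiable (at x)) \<and> (\<forall>i. Ck_on k (pd i f) S)"

definition smooth_on :: "(real^'n \<Rightarrow> real) \<Rightarrow> (real^'n) set \<Rightarrow> bool" where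
  "smooth_on f S \<longleftrightarrow> (\<forall>k. Ck_on k f S)"


section \<open>Smooth manifolds and tensor fields\<close>

text \<open>A chart is a pair of its domain and its coordinate map (only the values on the domain matter).\<close>

type_synonym ('a, 'n) chart = "'a set \<times> ('a \<Rightarrow> real^'n)"

abbreviation dom_chart :: "('a, 'n) chart \<Rightarrow> 'a set" where
  "dom_chart c \<equiv> fst c"

abbreviation coord :: "('a, 'n) chart \<Rightarrow> 'a \<Rightarrow> real^'n" where
  "coord c \<equiv> snd c"

definition img_chart :: "('a, 'n) chart \<Rightarrow> (real^'n) set" where
  "img_chart c = coord c ` dom_chart c"

definition inv_coord :: "('a, 'n) chart \<Rightarrow> real^'n \<Rightarrow> 'a" where
  "inv_coord c = inv_into (dom_chart c) (coord c)"

definition transition :: "('a, 'n) chart \<Rightarrow> ('a, 'n) chart \<Rightarrow> real^'n \<Rightarrow> real^'n" where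
  "transition c d = (\<lambda>x. coord d (inv_coord c x))"

text \<open>The atlas need not be maximal; its dimension is \<open>CARD('n)\<close>.\<close>

definition smooth_manifold :: "'a topology \<Rightarrow> ('a, 'n::finite) chart set \<Rightarrow> bool" where
  "smooth_manifold X \<A> \<longleftrightarrow>
     Hausdorff_space X \<and> second_countable X \<and>
     (\<Union>c\<in>\<A>. dom_chart c) = topspace X \<and>
     (\<forall>c\<in>\<A>. openin X (dom_chart c) \<and> open (img_chart c) \<and>
        homeomorphic_map (subtopology X (dom_chart c)) (top_of_set (img_chart c)) (coord c)) \<and>
     (\<forall>c\<in>\<A>. \<forall>d\<in>\<A>. \<forall>i.
        smooth_on (\<lambda>x. transition c d x $ i) (coord c ` (dom_chart c \<inter> dom_chart d)))"

definition smooth_scalar :: "('a, 'n::finite) chart set \<Rightarrow> ('a \<Rightarrow> real) \<Rightarrow> bool" where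
  "smooth_scalar \<A> f \<longleftrightarrow> (\<forall>c\<in>\<A>. smooth_on (\<lambda>x. f (inv_coord c x)) (img_chart c))"

text \<open>
  A tensor field of rank \<open>r\<close> is the family of its components: \<open>T c x [i\<^sub>1, \<dots>, i\<^sub>r]\<close> is the component
  in the chart \<open>c\<close> at the point with coordinates \<open>x \<in> img_chart c\<close>.  The components in different
  charts are tied together by the transformation law. Values for other \<open>x\<close> or index lists of another
  length are irrelevant.
\<close>

type_synonym 'n ltensor = "real^'n \<Rightarrow> 'n list \<Rightarrow> real"
type_synonym ('a, 'n) tensor = "('a, 'n) chart \<Rightarrow> 'n ltensor"

text \<open>\<open>jac c d p j i\<close> is the partial derivative of the \<open>j\<close>-th coordinate of \<open>d\<close> with respect to the
  \<open>i\<close>-th coordinate of \<open>c\<close> at the point \<open>p\<close>.\<close>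

definition jac :: "('a, 'n::finite) chart \<Rightarrow> ('a, 'n) chart \<Rightarrow> 'a \<Rightarrow> 'n \<Rightarrow> 'n \<Rightarrow> real" where
  "jac c d p j i = pd i (\<lambda>x. transition c d x $ j) (coord c p)"

definition smooth_components :: "('a, 'n::finite) chart set \<Rightarrow> nat \<Rightarrow> ('a, 'n) tensor \<Rightarrow> bool" where
  "smooth_components \<A> r T \<longleftrightarrow>
     (\<forall>c\<in>\<A>. \<forall>is. length is = r \<longrightarrow> smooth_on (\<lambda>x. T c x is) (img_chart c))"

text \<open>Tensor fields of type \<open>(0,r)\<close> (\<open>r\<close> lower indices), and of type \<open>(r,0)\<close> (\<open>r\<close> upper indices).\<close>

definition covariant_tensor :: "('a, 'n::finite) chart set \<Rightarrow> nat \<Rightarrow> ('a, 'n) tensor \<Rightarrow> bool" where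
  "covariant_tensor \<A> r T \<longleftrightarrow> smooth_components \<A> r T \<and>
     (\<forall>c\<in>\<A>. \<forall>d\<in>\<A>. \<forall>p \<in> dom_chart c \<inter> dom_chart d. \<forall>is. length is = r \<longrightarrow>
        T c (coord c p) is =
        (\<Sum>js | length js = r. (\<Prod>a<r. jac c d p (js ! a) (is ! a)) * T d (coord d p) js))"

definition contravariant_tensor :: "('a, 'n::finite) chart set \<Rightarrow> nat \<Rightarrow> ('a, 'n) tensor \<Rightarrow> bool" where
  "contravariant_tensor \<A> r T \<longleftrightarrow> smooth_components \<A> r T \<and>
     (\<forall>c\<in>\<A>. \<forall>d\<in>\<A>. \<forall>p \<in> dom_chart c \<inter> dom_chart d. \<forall>is. length is = r \<longrightarrow>
        T c (coord c p) is =
        (\<Sum>js | length js = r. (\<Prod>a<r. jac d c p (is ! a) (js ! a)) * T d (coord d p) js))"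

definition riemannian_manifold ::
    "'a topology \<Rightarrow> ('a, 'n::finite) chart set \<Rightarrow> ('a, 'n) tensor \<Rightarrow> bool" where
  "riemannian_manifold X \<A> g \<longleftrightarrow>
     smooth_manifold X \<A> \<and> covariant_tensor \<A> 2 g \<and>
     (\<forall>c\<in>\<A>. \<forall>x\<in>img_chart c.
        (\<forall>i j. g c x [i, j] = g c x [j, i]) \<and>
        (\<forall>v::real^'n. v \<noteq> 0 \<longrightarrow> (\<Sum>i\<in>UNIV. \<Sum>j\<in>UNIV. g c x [i, j] * v $ i * v $ j) > 0))"


section \<open>Levi-Civita connection and curvature in a chart\<close>

text \<open>In this section \<open>g\<close> stands for the components \<open>g c\<close> of the metric in one chart.\<close>

definition metric_inv :: "'n::finite ltensor \<Rightarrow> real^'n \<Rightarrow> 'n \<Rightarrow> 'n \<Rightarrow> real" where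
  "metric_inv g x m s = matrix_inv (\<chi> i j. g x [i, j]) $ m $ s"

text \<open>\<open>christoffel g m k l x\<close> is the Christoffel symbol with upper index \<open>m\<close> and lower indices \<open>k\<close>, \<open>l\<close>.\<close>

definition christoffel :: "'n::finite ltensor \<Rightarrow> 'n \<Rightarrow> 'n \<Rightarrow> 'n \<Rightarrow> real^'n \<Rightarrow> real" where
  "christoffel g m k l x =
     (\<Sum>s\<in>UNIV. metric_inv g x m s *
        (pd k (\<lambda>y. g y [s, l]) x + pd l (\<lambda>y. g y [k, s]) x - pd s (\<lambda>y. g y [k, l]) x)) / 2"

text \<open>
  Covariant derivative of a covariant tensor of any rank; the index of differentiation comes first,
  i.e. \<open>nabla g T x (k # ls)\<close> is \<open>\<nabla>\<^sub>k T\<close> with indices \<open>ls\<close>, and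
  \<open>nabla g (nabla g T) x (i # k # ls)\<close> is \<open>\<nabla>\<^sub>i \<nabla>\<^sub>k T\<close> with indices \<open>ls\<close>.
  The empty list, for which there is no index of differentiation, gets a dummy value.
\<close>

fun nabla :: "'n::finite ltensor \<Rightarrow> 'n ltensor \<Rightarrow> 'n ltensor" where
  "nabla g T x (k # ls) = pd k (\<lambda>y. T y ls) x -
     (\<Sum>a<length ls. \<Sum>s\<in>UNIV. christoffel g s k (ls ! a) x * T x (ls[a := s]))"
| "nabla g T x [] = 0"

text \<open>
  \<open>riemann g i k l m x\<close> is the component with lower indices \<open>i, k, l\<close> and upper index \<open>m\<close>.  Signs and
  index positions are those of the Ricci identity
  \<open>(\<nabla>\<^sub>i \<nabla>\<^sub>k - \<nabla>\<^sub>k \<nabla>\<^sub>i) v\<^sub>l = \<Sum>m. riemann g i k l m x * v\<^sub>m\<close> for covectors \<open>v\<close>: expanding its left-hand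
  side, all derivatives of \<open>v\<close> cancel, and the coefficient of \<open>v\<^sub>m\<close> is the expression below.
\<close>

definition riemann :: "'n::finite ltensor \<Rightarrow> 'n \<Rightarrow> 'n \<Rightarrow> 'n \<Rightarrow> 'n \<Rightarrow> real^'n \<Rightarrow> real" where
  "riemann g i k l m x =
     pd k (christoffel g m i l) x - pd i (christoffel g m k l) x +
     (\<Sum>t\<in>UNIV. christoffel g t i l x * christoffel g m k t x
              - christoffel g t k l x * christoffel g m i t x)"

text \<open>The last index is lowered.\<close>

definition riemann_low :: "'n::finite ltensor \<Rightarrow> 'n ltensor" where
  "riemann_low g x is =
     (\<Sum>s\<in>UNIV. riemann g (is ! 0) (is ! 1) (is ! 2) s x * g x [s, is ! 3])"

definition ricci :: "'n::finite ltensor \<Rightarrow> 'n ltensor" where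
  "ricci g x is = - (\<Sum>m\<in>UNIV. riemann g m (is ! 0) (is ! 1) m x)"


section \<open>Weakly Z symmetric and generalized Ricci pseudosymmetric manifolds\<close>

definition Z_tensor :: "('a, 'n::finite) tensor \<Rightarrow> ('a \<Rightarrow> real) \<Rightarrow> ('a, 'n) tensor" where
  "Z_tensor g \<phi> c x is = ricci (g c) x is + \<phi> (inv_coord c x) * g c x is"

definition weakly_Z_symmetric ::
    "('a, 'n::finite) chart set \<Rightarrow> ('a, 'n) tensor \<Rightarrow> ('a \<Rightarrow> real) \<Rightarrow>
     ('a, 'n) tensor \<Rightarrow> ('a, 'n) tensor \<Rightarrow> ('a, 'n) tensor \<Rightarrow> bool" where
  "weakly_Z_symmetric \<A> g \<phi> A B D \<longleftrightarrow>
     smooth_scalar \<A> \<phi> \<and>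
     covariant_tensor \<A> 1 A \<and> covariant_tensor \<A> 1 B \<and> covariant_tensor \<A> 1 D \<and>
     (\<forall>c\<in>\<A>. \<forall>x\<in>img_chart c. \<forall>k j l.
        (let Z = Z_tensor g \<phi> c in
           nabla (g c) Z x [k, j, l] =
             A c x [k] * Z x [j, l] + B c x [j] * Z x [k, l] + D c x [l] * Z x [k, j]))"

definition Z_nonsingular ::
    "('a, 'n::finite) chart set \<Rightarrow> ('a, 'n) tensor \<Rightarrow> ('a \<Rightarrow> real) \<Rightarrow> bool" where
  "Z_nonsingular \<A> g \<phi> \<longleftrightarrow>
     (\<exists>W. contravariant_tensor \<A> 2 W \<and>
        (\<forall>c\<in>\<A>. \<forall>x\<in>img_chart c. \<forall>h l.
           (\<Sum>k\<in>UNIV. W c x [k, h] * Z_tensor g \<phi> c x [k, l]) = (if h = l then 1 else 0)))"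

text \<open>"Non null" is read as "not identically zero", and no regularity of \<open>L\<close> is required.\<close>

definition generalized_Ricci_pseudosymmetric ::
    "'a topology \<Rightarrow> ('a, 'n::finite) chart set \<Rightarrow> ('a, 'n) tensor \<Rightarrow> ('a \<Rightarrow> real) \<Rightarrow> bool" where
  "generalized_Ricci_pseudosymmetric X \<A> g L \<longleftrightarrow>
     (\<exists>p\<in>topspace X. L p \<noteq> 0) \<and>
     (\<forall>c\<in>\<A>. \<forall>x\<in>img_chart c. \<forall>s i j k l m.
        (let Rm = riemann_low (g c); Rc = ricci (g c) in
           nabla (g c) (nabla (g c) Rm) x [s, i, j, k, l, m]
           - nabla (g c) (nabla (g c) Rm) x [i, s, j, k, l, m] =
           L (inv_coord c x) *
             (Rc x [j, s] * Rm x [i, k, l, m] - Rc x [j, i] * Rm x [s, k, l, m]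
            + Rc x [k, s] * Rm x [j, i, l, m] - Rc x [k, i] * Rm x [j, s, l, m]
            + Rc x [l, s] * Rm x [j, k, i, m] - Rc x [l, i] * Rm x [j, k, s, m]
            + Rc x [m, s] * Rm x [j, k, l, i] - Rc x [m, i] * Rm x [j, k, l, s])))"

definition closed_form ::
    "('a, 'n::finite) chart set \<Rightarrow> ('a, 'n) tensor \<Rightarrow> ('a, 'n) tensor \<Rightarrow> bool" where
  "closed_form \<A> g \<omega> \<longleftrightarrow>
     (\<forall>c\<in>\<A>. \<forall>x\<in>img_chart c. \<forall>i j.
        nabla (g c) (\<omega> c) x [i, j] - nabla (g c) (\<omega> c) x [j, i] = 0)"

end

theory Submission
  imports Defs
begin

text \<open>
  Symmetry of \<open>Z\<close> and non-singularity give \<open>B = D\<close>, so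
  \<open>\<nabla>\<^sub>k Z\<^sub>j\<^sub>l - \<nabla>\<^sub>j Z\<^sub>k\<^sub>l = \<omega>\<^sub>k Z\<^sub>j\<^sub>l - \<omega>\<^sub>j Z\<^sub>k\<^sub>l\<close>.  Differentiating, summing cyclically and using
  the Ricci identity and the first Bianchi identity yields
  \<open>d\<omega>\<^sub>i\<^sub>k Z\<^sub>j\<^sub>l + d\<omega>\<^sub>k\<^sub>j Z\<^sub>i\<^sub>l + d\<omega>\<^sub>j\<^sub>i Z\<^sub>k\<^sub>l = C\<close>, where \<open>C\<close> is the cyclic sum of
  \<open>R\<^sub>j\<^sup>m R\<^sub>i\<^sub>k\<^sub>l\<^sub>m\<close> over \<open>i, k, j\<close>.  Contracting the pseudosymmetry condition with the metric and
  summing cyclically gives \<open>(1 + 3 L) C = 0\<close>, hence \<open>C = 0\<close>; contracting the remaining identity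
  with the inverse of \<open>Z\<close> then gives \<open>(n - 2) d\<omega> = 0\<close>.  Everything is done in a single chart.
\<close>

section \<open>Calculus of smooth functions\<close>

text \<open>\<open>frechet_derivative\<close> is a Hilbert choice. As \<open>f\<close> and
  \<open>g\<close> agree near \<open>x\<close>, the same maps are derivatives of both, so the
  choices coincide even where no derivative exists.\<close>

lemma pd_cong:
  assumes "open S" "x \<in> S" "\<And>y. y \<in> S \<Longrightarrow> f y = g y"
  shows "pd i f x = pd i g x"
proof -
  have "(f has_derivative f') (at x) \<longleftrightarrow> (g has_derivative f') (at x)" for f'
    using assms has_derivative_transform_within_open[of f f' x UNIV S g]
      has_derivative_transform_within_open[of g f' x UNIV S f] by auto
  then show ?thesis
    unfolding pd_def frechet_derivative_def by simp
qed

lemma has_derivative_pd: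
  assumes "(f has_derivative f') (at x)"
  shows "pd i f x = f' (axis i 1)"
  unfolding pd_def frechet_derivative_at[OF assms, symmetric] ..

lemma pd_const [simp]: "pd i (\<lambda>y. c) x = 0"
  by (simp add: pd_def)

lemma pd_add:
  assumes "f differentiable at x" "g differentiable at x"
  shows "pd i (\<lambda>y. f y + g y) x = pd i f x + pd i g x"
  using has_derivative_pd[OF has_derivative_add[OF assms[unfolded frechet_derivative_works]]]
  by (simp add: pd_def)

lemma pd_diff:
  assumes "f differentiable at x" "g differentiable at x"
  shows "pd i (\<lambda>y. f y - g y) x = pd i f x - pd i g x"
  using has_derivative_pd[OF has_derivative_diff[OF assms[unfolded frechet_derivative_works]]]
  by (simp add: pd_def)

lemma pd_mult:
  assumes "f differentiable at x" "g differentiable at x"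
  shows "pd i (\<lambda>y. f y * g y) x = f x * pd i g x + pd i f x * g x"
  using has_derivative_pd[OF has_derivative_mult[OF assms[unfolded frechet_derivative_works]]]
  by (simp add: pd_def)

lemma pd_inverse:
  assumes "f differentiable at x" "f x \<noteq> 0"
  shows "pd i (\<lambda>y. inverse (f y)) x = - (inverse (f x) * pd i f x * inverse (f x))"
  using has_derivative_pd[OF Deriv.has_derivative_inverse[OF assms(2) assms(1)[unfolded frechet_derivative_works]]]
  by (simp add: pd_def)

lemma pd_sum:
  assumes "\<And>a. a \<in> I \<Longrightarrow> f a differentiable at x"
  shows "pd i (\<lambda>y. \<Sum>a\<in>I. f a y) x = (\<Sum>a\<in>I. pd i (f a) x)"
proof -
  have "((\<lambda>y. \<Sum>a\<in>I. f a y) has_derivative (\<lambda>h. \<Sum>a\<in>I. frechet_derivative (f a) (at x) h)) (at x)"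
    by (intro has_derivative_sum assms[unfolded frechet_derivative_works])
  from has_derivative_pd[OF this] show ?thesis
    by (simp add: pd_def)
qed

section \<open>Closure properties of smooth functions\<close>

lemma Ck_on_cong:
  assumes "open S" "Ck_on k f S" "\<And>y. y \<in> S \<Longrightarrow> f y = g y"
  shows "Ck_on k g S"
  using assms(2,3)
proof (induction k arbitrary: f g)
  case 0
  then show ?case using continuous_on_cong[of S S f g] by simp
next
  case (Suc k)
  have "g differentiable at x" if "x \<in> S" for x
  proof -
    have "(f has_derivative frechet_derivative f (at x)) (at x)"
      using Suc.prems(1) that by (simp flip: frechet_derivative_works)
    from has_derivative_transform_within_open[OF this assms(1) that Suc.prems(2)]
    show ?thesis by (rule differentiableI)
  qed
  moreover have "Ck_on k (pd i g) S" for i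
    by (rule Suc.IH[of "pd i f"]) (use Suc.prems(1) pd_cong[OF assms(1) _ Suc.prems(2)] in simp_all)
  ultimately show ?case by simp
qed

lemma smooth_onD_differentiable: "smooth_on f S \<Longrightarrow> x \<in> S \<Longrightarrow> f differentiable at x"
  unfolding smooth_on_def by (auto dest: spec[of _ "Suc 0"])

lemma smooth_onD_continuous: "smooth_on f S \<Longrightarrow> continuous_on S f"
  unfolding smooth_on_def by (auto dest: spec[of _ 0])

lemma smooth_on_pd: "smooth_on f S \<Longrightarrow> smooth_on (pd i f) S"
  unfolding smooth_on_def
proof
  fix k assume "\<forall>k. Ck_on k f S"
  then have "Ck_on (Suc k) f S" ..
  then show "Ck_on k (pd i f) S" by simp
qed

lemma smooth_on_cong:
  "open S \<Longrightarrow> smooth_on f S \<Longrightarrow> (\<And>y. y \<in> S \<Longrightarrow> f y = g y) \<Longrightarrow> smooth_on g S"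
  unfolding smooth_on_def by (auto intro: Ck_on_cong[of S _ f])

lemma smooth_on_const: "smooth_on (\<lambda>x. c) (S :: (real^'a) set)"
proof -
  have "Ck_on k (\<lambda>x. c) S" for k c
  proof (induction k arbitrary: c)
    case (Suc k)
    moreover have "pd i (\<lambda>x. c) = (\<lambda>x. 0)" for i :: 'a by (rule ext) simp
    ultimately show ?case by simp
  qed simp
  then show ?thesis by (simp add: smooth_on_def)
qed

lemma Ck_on_add:
  assumes "open S" "Ck_on k f S" "Ck_on k g S"
  shows "Ck_on k (\<lambda>x. f x + g x) S"
  using assms(2,3)
proof (induction k arbitrary: f g)
  case 0
  then show ?case by (auto intro: continuous_on_add)
next
  case (Suc k)
  have "Ck_on k (pd i (\<lambda>x. f x + g x)) S" for i
    by (rule Ck_on_cong[OF assms(1) Suc.IH[of "pd i f" "pd i g"]]) (use Suc.prems in \<open>auto simp: pd_add\<close>)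
  with Suc.prems show ?case by auto
qed

lemma smooth_on_add:
  "open S \<Longrightarrow> smooth_on f S \<Longrightarrow> smooth_on g S \<Longrightarrow> smooth_on (\<lambda>x. f x + g x) S"
  unfolding smooth_on_def by (auto intro: Ck_on_add)

lemma smooth_on_mult:
  assumes "open S" "smooth_on f S" "smooth_on g S"
  shows "smooth_on (\<lambda>x. f x * g x) S"
proof -
  \<comment> \<open>The induction carries smoothness of both factors: the product rule leaves one
    factor undifferentiated, and being smooth it can be passed to the induction hypothesis
    unchanged.\<close>
  have "Ck_on k (\<lambda>x. f x * g x) S" for k
    using assms(2,3)
  proof (induction k arbitrary: f g)
    case 0
    then show ?case by (simp add: continuous_on_mult smooth_onD_continuous)
  next
    case (Suc k)
    have "Ck_on k (pd i (\<lambda>x. f x * g x)) S" for i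
      by (rule Ck_on_cong[OF assms(1) Ck_on_add[OF assms(1) Suc.IH[of f "pd i g"] Suc.IH[of "pd i f" g]]])
        (simp_all add: Suc.prems smooth_on_pd pd_mult[OF Suc.prems[THEN smooth_onD_differentiable]])
    with Suc.prems show ?case
      by (auto intro!: differentiable_mult simp: smooth_onD_differentiable)
  qed
  then show ?thesis unfolding smooth_on_def ..
qed

lemma smooth_on_minus:
  assumes "open S" "smooth_on f S"
  shows "smooth_on (\<lambda>x. - f x) S"
  using smooth_on_mult[OF assms(1) smooth_on_const[of "-1"] assms(2)] by simp

lemma smooth_on_diff:
  assumes "open S" "smooth_on f S" "smooth_on g S"
  shows "smooth_on (\<lambda>x. f x - g x) S"
  using smooth_on_add[OF assms(1,2) smooth_on_minus[OF assms(1,3)]] by simp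

lemma smooth_on_sum:
  assumes "open S" "\<And>a. a \<in> I \<Longrightarrow> smooth_on (f a) S"
  shows "smooth_on (\<lambda>x. \<Sum>a\<in>I. f a x) S"
  using assms(2)
proof (induction I rule: infinite_finite_induct)
  case (insert a I)
  then show ?case using smooth_on_add[OF assms(1)] by simp
qed (auto intro: smooth_on_const)

lemma smooth_on_prod:
  assumes "open S" "\<And>a. a \<in> I \<Longrightarrow> smooth_on (f a) S"
  shows "smooth_on (\<lambda>x. \<Prod>a\<in>I. f a x) S"
  using assms(2)
proof (induction I rule: infinite_finite_induct)
  case (insert a I)
  then show ?case using smooth_on_mult[OF assms(1)] by simp
qed (auto intro: smooth_on_const)

lemma smooth_on_inverse:
  assumes "open S" "smooth_on f S" "\<And>x. x \<in> S \<Longrightarrow> f x \<noteq> 0"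
  shows "smooth_on (\<lambda>x. inverse (f x)) S"
proof -
  text \<open>The numerator \<open>h\<close> keeps the class of functions closed under differentiation:
    \<open>(h / f\<^sup>n)' = h' / f\<^sup>n - n h f' / f\<^sup>n\<^sup>+\<^sup>1\<close>.\<close>
  have "Ck_on k (\<lambda>x. h x * inverse (f x) ^ n) S" if "smooth_on h S" for k n h
    using that
  proof (induction k arbitrary: h n)
    case 0
    then show ?case
      by (simp add: assms continuous_on_mult continuous_on_power continuous_on_inverse smooth_onD_continuous)
  next
    case (Suc k)
    have dinv: "(\<lambda>x. inverse (f x)) differentiable at x" if "x \<in> S" for x
      using assms that by (intro differentiable_inverse smooth_onD_differentiable)
    have dpow: "(\<lambda>x. inverse (f x) ^ n) differentiable at x" if "x \<in> S" for x
      using dinv[OF that] by (rule differentiable_power)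
    have pdpow: "pd i (\<lambda>x. inverse (f x) ^ n) x = - (real n * pd i f x) * inverse (f x) ^ Suc n"
      if "x \<in> S" for i x
      using has_derivative_pd[OF has_derivative_power[OF dinv[OF that, unfolded frechet_derivative_works], of n], of i]
        pd_inverse[OF smooth_onD_differentiable[OF assms(2) that] assms(3)[OF that], of i]
      by (cases n) (auto simp: pd_def)
    have "Ck_on k (\<lambda>x. pd i h x * inverse (f x) ^ n + (h x * - (real n * pd i f x)) * inverse (f x) ^ Suc n) S" for i
      using assms Suc.prems
      by (intro Ck_on_add Suc.IH smooth_on_mult smooth_on_minus smooth_on_const smooth_on_pd)
    then have "Ck_on k (pd i (\<lambda>x. h x * inverse (f x) ^ n)) S" for i
      by (rule Ck_on_cong[OF assms(1), where f = "\<lambda>x. pd i h x * inverse (f x) ^ n + (h x * - (real n * pd i f x)) * inverse (f x) ^ Suc n"])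
        (simp add: pd_mult[OF smooth_onD_differentiable[OF Suc.prems] dpow] pdpow)
    moreover have "(\<lambda>x. h x * inverse (f x) ^ n) differentiable at x" if "x \<in> S" for x
      using that dpow Suc.prems by (intro differentiable_mult) (auto simp: smooth_onD_differentiable)
    ultimately show ?case by simp
  qed
  from this[OF smooth_on_const[of 1], of _ 1] show ?thesis by (simp add: smooth_on_def)
qed

section \<open>Determinants and inverse matrices\<close>

lemma smooth_on_det:
  fixes M :: "real^'n \<Rightarrow> real^'m^'m"
  assumes "open S" "\<And>i j. smooth_on (\<lambda>x. M x $ i $ j) S"
  shows "smooth_on (\<lambda>x. det (M x)) S"
  unfolding det_def
  by (intro smooth_on_sum smooth_on_mult smooth_on_const smooth_on_prod assms)

lemma matrix_inv_right_left:
  fixes M :: "real^'n^'n"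
  assumes "invertible M"
  shows "M ** matrix_inv M = mat 1" "matrix_inv M ** M = mat 1"
  using someI_ex[OF assms[unfolded invertible_def]] by (auto simp: matrix_inv_def)

text \<open>Cramer's rule writes each entry of the inverse as a quotient of two determinants, which
  are polynomials in the matrix entries.\<close>

lemma smooth_on_matrix_inv:
  fixes M :: "real^'n \<Rightarrow> real^'m^'m"
  assumes "open S" "\<And>i j. smooth_on (\<lambda>x. M x $ i $ j) S" "\<And>x. x \<in> S \<Longrightarrow> invertible (M x)"
  shows "smooth_on (\<lambda>x. matrix_inv (M x) $ m $ s) S"
proof (rule smooth_on_cong[OF assms(1)])
  \<comment> \<open>\<open>?C x\<close> is \<open>M x\<close> with column \<open>m\<close> replaced
    by \<open>axis s 1\<close>, because column \<open>s\<close> of the inverse solves the linear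
    system with that right-hand side.\<close>
  let ?C = "\<lambda>x. (\<chi> i j. if j = m then (axis s 1 :: real^'m) $ i else M x $ i $ j) :: real^'m^'m"
  show "smooth_on (\<lambda>x. det (?C x) * inverse (det (M x))) S"
  proof (intro smooth_on_mult smooth_on_inverse smooth_on_det assms)
    show "smooth_on (\<lambda>x. ?C x $ i $ j) S" for i j
      by (cases "j = m") (auto intro: smooth_on_const assms)
  qed (use assms(3) invertible_det_nz in auto)
  fix x assume x: "x \<in> S"
  have "M x *v (matrix_inv (M x) *v axis s 1) = axis s 1"
    by (simp add: matrix_vector_mul_assoc matrix_inv_right_left assms(3)[OF x])
  then have "matrix_inv (M x) *v axis s 1 =
      (\<chi> k. det (\<chi> i j. if j = k then (axis s 1 :: real^'m) $ i else M x $ i $ j) / det (M x))"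
    by (subst (asm) cramer) (use assms(3)[OF x] invertible_det_nz in auto)
  from arg_cong[OF this, of "\<lambda>v. v $ m"]
  show "det (?C x) * inverse (det (M x)) = matrix_inv (M x) $ m $ s"
    by (simp add: divide_inverse matrix_vector_mult_basis column_def)
qed

section \<open>Symmetry of second partial derivatives\<close>

lemma has_real_derivative_line:
  assumes "f differentiable at (y + t *\<^sub>R axis i 1)"
  shows "((\<lambda>t. f (y + t *\<^sub>R axis i 1)) has_real_derivative pd i f (y + t *\<^sub>R axis i 1)) (at t)"
proof -
  let ?f' = "frechet_derivative f (at (y + t *\<^sub>R axis i 1))"
  have f': "(f has_derivative ?f') (at (y + t *\<^sub>R axis i 1))"
    using assms by (simp add: frechet_derivative_works)
  have "((\<lambda>t. y + t *\<^sub>R axis i 1) has_derivative (\<lambda>h. h *\<^sub>R axis i 1)) (at t)"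
    by (auto intro!: derivative_eq_intros)
  from has_derivative_compose[OF this f']
  have "((\<lambda>t. f (y + t *\<^sub>R axis i 1)) has_derivative (\<lambda>h. ?f' (h *\<^sub>R axis i 1))) (at t)" .
  then show ?thesis
    by (simp add: has_field_derivative_def pd_def linear_cmul[OF has_derivative_linear[OF f']] mult.commute[of _ "?f' _"])
qed

text \<open>Two uses of the mean value theorem: along \<open>axis i\<close> for the difference of
  two translates of \<open>f\<close>, then along \<open>axis j\<close> for \<open>pd i f\<close>.
  The second difference itself is symmetric in \<open>i\<close> and \<open>j\<close>.\<close>

lemma second_difference:
  assumes "smooth_on f S" "cball x (2 * h) \<subseteq> S" "h > 0"
  obtains y where "y \<in> cball x (2 * h)"
    "f (x + h *\<^sub>R axis j 1 + h *\<^sub>R axis i 1) - f (x + h *\<^sub>R axis i 1)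
       - (f (x + h *\<^sub>R axis j 1) - f x) = h * (h * pd j (pd i f) y)"
proof -
  \<comment> \<open>Basis vectors have norm 1, so these points lie within \<open>s + t\<close> of
    \<open>x\<close>; hence the radius \<open>2 * h\<close>.\<close>
  have mem: "x + s *\<^sub>R axis j 1 + t *\<^sub>R axis i 1 \<in> cball x (2 * h)"
    if "0 \<le> s" "s \<le> h" "0 \<le> t" "t \<le> h" for s t
  proof -
    have "norm (s *\<^sub>R axis j 1 + t *\<^sub>R axis i 1 :: real^'a) \<le> s * 1 + t * 1"
      using that by (intro norm_triangle_le add_mono) auto
    moreover have "dist x (x + s *\<^sub>R axis j 1 + t *\<^sub>R axis i 1) = norm (s *\<^sub>R axis j 1 + t *\<^sub>R axis i 1 :: real^'a)"
      by (subst dist_commute) (simp add: dist_norm add.assoc)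
    ultimately show ?thesis using that by simp
  qed
  then have inS: "x + s *\<^sub>R axis j 1 + t *\<^sub>R axis i 1 \<in> S"
    if "0 \<le> s" "s \<le> h" "0 \<le> t" "t \<le> h" for s t
    using that assms(2) by blast
  let ?u = "\<lambda>t. f (x + h *\<^sub>R axis j 1 + t *\<^sub>R axis i 1) - f (x + t *\<^sub>R axis i 1)"
  have "(?u has_real_derivative pd i f (x + h *\<^sub>R axis j 1 + t *\<^sub>R axis i 1) - pd i f (x + t *\<^sub>R axis i 1)) (at t)"
    if "0 \<le> t" "t \<le> h" for t
    using that inS[of h t] inS[of 0 t] assms(1,3)
    by (intro DERIV_diff has_real_derivative_line) (auto intro: smooth_onD_differentiable)
  from MVT2[OF assms(3) this] obtain t where t: "0 < t" "t < h"
    "?u h - ?u 0 = h * (pd i f (x + h *\<^sub>R axis j 1 + t *\<^sub>R axis i 1) - pd i f (x + t *\<^sub>R axis i 1))"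
    by auto
  have swap: "x + t *\<^sub>R axis i 1 + s *\<^sub>R axis j 1 = x + s *\<^sub>R axis j 1 + t *\<^sub>R axis i 1" for s
    by simp
  have "((\<lambda>s. pd i f (x + t *\<^sub>R axis i 1 + s *\<^sub>R axis j 1)) has_real_derivative
      pd j (pd i f) (x + t *\<^sub>R axis i 1 + s *\<^sub>R axis j 1)) (at s)" if "0 \<le> s" "s \<le> h" for s
    using that inS[of s t] t assms(1)
    by (intro has_real_derivative_line smooth_onD_differentiable[OF smooth_on_pd]) (auto simp: swap)
  from MVT2[OF assms(3) this] obtain s where s: "0 < s" "s < h"
    "pd i f (x + t *\<^sub>R axis i 1 + h *\<^sub>R axis j 1) - pd i f (x + t *\<^sub>R axis i 1 + 0 *\<^sub>R axis j 1)
     = h * pd j (pd i f) (x + t *\<^sub>R axis i 1 + s *\<^sub>R axis j 1)"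
    by auto
  show thesis
  proof
    show "x + s *\<^sub>R axis j 1 + t *\<^sub>R axis i 1 \<in> cball x (2 * h)"
      using mem s t by simp
  qed (use s(3) t(3) in \<open>simp add: swap\<close>)
qed

text \<open>Schwarz's theorem. At suitable points near \<open>x\<close> both mixed derivatives equal
  the same second difference divided by \<open>h * h\<close>; if they differed by
  \<open>2 * e\<close> at \<open>x\<close>, continuity would exclude this for small
  \<open>h\<close>.\<close>

lemma pd_commute:
  assumes "open S" "smooth_on f S" "x \<in> S"
  shows "pd i (pd j f) x = pd j (pd i f) x"
proof (rule ccontr)
  let ?p = "pd i (pd j f)" and ?q = "pd j (pd i f)"
  assume "?p x \<noteq> ?q x"
  define e where "e = \<bar>?p x - ?q x\<bar> / 2"
  have "e > 0" using \<open>?p x \<noteq> ?q x\<close> by (simp add: e_def)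
  have cont: "continuous (at x) ?p" "continuous (at x) ?q"
    using assms by (auto intro!: smooth_onD_continuous[THEN continuous_on_interior] smooth_on_pd
        simp: interior_open)
  obtain d1 where d1: "d1 > 0" "\<And>y. dist y x < d1 \<Longrightarrow> dist (?p y) (?p x) < e"
    using cont(1) \<open>e > 0\<close> unfolding continuous_at_eps_delta by metis
  obtain d2 where d2: "d2 > 0" "\<And>y. dist y x < d2 \<Longrightarrow> dist (?q y) (?q x) < e"
    using cont(2) \<open>e > 0\<close> unfolding continuous_at_eps_delta by metis
  obtain r where r: "r > 0" "cball x r \<subseteq> S"
    using assms open_contains_cball by blast
  define h where "h = min r (min d1 d2) / 3"
  have h: "h > 0" "2 * h < r" "2 * h < d1" "2 * h < d2"
    using r(1) d1(1) d2(1) by (auto simp: h_def min_def)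
  then have sub: "cball x (2 * h) \<subseteq> S" using r(2) by auto
  obtain y where y: "y \<in> cball x (2 * h)" "f (x + h *\<^sub>R axis j 1 + h *\<^sub>R axis i 1) - f (x + h *\<^sub>R axis i 1)
       - (f (x + h *\<^sub>R axis j 1) - f x) = h * (h * ?q y)"
    using second_difference[OF assms(2) sub h(1)] by blast
  obtain z where z: "z \<in> cball x (2 * h)" "f (x + h *\<^sub>R axis i 1 + h *\<^sub>R axis j 1) - f (x + h *\<^sub>R axis j 1)
       - (f (x + h *\<^sub>R axis i 1) - f x) = h * (h * ?p z)"
    using second_difference[OF assms(2) sub h(1)] by blast
  have "x + h *\<^sub>R axis i 1 + h *\<^sub>R axis j 1 = x + h *\<^sub>R axis j 1 + h *\<^sub>R axis i 1"
    by simp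
  then have "h * (h * ?q y) = h * (h * ?p z)"
    using y(2) z(2) by (simp only:)
  then have "?q y = ?p z" using h(1) by simp
  moreover have "dist (?q y) (?q x) < e" "dist (?p z) (?p x) < e"
    using d2(2)[of y] d1(2)[of z] y(1) z(1) h by (simp_all add: dist_commute)
  ultimately show False
    unfolding e_def dist_real_def by (simp add: abs_if split: if_splits)
qed

section \<open>The Ricci identity\<close>

lemma nabla_1: "nabla g T x [k, a] = pd k (\<lambda>y. T y [a]) x - (\<Sum>s\<in>UNIV. christoffel g s k a x * T x [s])"
  by simp

lemma nabla_2: "nabla g T x [k, a, b] = pd k (\<lambda>y. T y [a, b]) x
    - (\<Sum>s\<in>UNIV. christoffel g s k a x * T x [s, b]) - (\<Sum>s\<in>UNIV. christoffel g s k b x * T x [a, s])"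
  by (simp add: numeral_2_eq_2)

lemma nabla_3: "nabla g T x [k, a, b, c] = pd k (\<lambda>y. T y [a, b, c]) x
    - (\<Sum>s\<in>UNIV. christoffel g s k a x * T x [s, b, c]) - (\<Sum>s\<in>UNIV. christoffel g s k b x * T x [a, s, c])
    - (\<Sum>s\<in>UNIV. christoffel g s k c x * T x [a, b, s])"
  by (simp add: numeral_3_eq_3)

lemma nabla_cong:
  assumes "open U" "x \<in> U" "length ls = r"
    and "\<And>y ls. y \<in> U \<Longrightarrow> length ls = r \<Longrightarrow> T y ls = T' y ls"
  shows "nabla g T x (k # ls) = nabla g T' x (k # ls)"
proof -
  have "pd k (\<lambda>y. T y ls) x = pd k (\<lambda>y. T' y ls) x"
    using assms by (intro pd_cong[OF assms(1,2)]) auto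
  then show ?thesis
    using assms by simp
qed

text \<open>The data of a single chart: coordinates in an open set and the metric components there.
  Positive definiteness appears as invertibility of the component matrix, the form that the inverse
  metric \<open>h\<close> calls for.\<close>

locale metric_chart =
  fixes U :: "(real^'n::finite) set" and G :: "'n ltensor"
  assumes open_U: "open U"
    and smooth_metric: "\<And>i j. smooth_on (\<lambda>x. G x [i, j]) U"
    and metric_sym: "\<And>x i j. x \<in> U \<Longrightarrow> G x [i, j] = G x [j, i]"
    and metric_invertible: "\<And>x. x \<in> U \<Longrightarrow> invertible (\<chi> i j. G x [i, j])"
begin

abbreviation \<Gamma> where "\<Gamma> \<equiv> christoffel G"
abbreviation Ru where "Ru x i k l m \<equiv> riemann G i k l m x"
abbreviation Rm where "Rm x i k l m \<equiv> riemann_low G x [i, k, l, m]"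
abbreviation Rc where "Rc x k l \<equiv> ricci G x [k, l]"
abbreviation h where "h \<equiv> metric_inv G"

lemmas diff_at = smooth_onD_differentiable

lemma h_metric:
  assumes "x \<in> U"
  shows "(\<Sum>s\<in>UNIV. h x m s * G x [s, l]) = (if m = l then 1 else 0)"
    and "(\<Sum>s\<in>UNIV. G x [m, s] * h x s l) = (if m = l then 1 else 0)"
proof -
  let ?M = "\<chi> i j. G x [i, j]"
  note inv = matrix_inv_right_left[OF metric_invertible[OF assms]]
  show "(\<Sum>s\<in>UNIV. h x m s * G x [s, l]) = (if m = l then 1 else 0)"
    using arg_cong[OF inv(2), of "\<lambda>M. M $ m $ l"]
    by (simp add: matrix_matrix_mult_def mat_def metric_inv_def)
  show "(\<Sum>s\<in>UNIV. G x [m, s] * h x s l) = (if m = l then 1 else 0)"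
    using arg_cong[OF inv(1), of "\<lambda>M. M $ m $ l"]
    by (simp add: matrix_matrix_mult_def mat_def metric_inv_def)
qed

text \<open>For symmetric \<open>G\<close> the triple product of \<open>h\<close>, \<open>G\<close>
  and the transpose of \<open>h\<close> collapses to \<open>h\<close> from the right and to its
  transpose from the left.\<close>

lemma h_sym:
  assumes "x \<in> U"
  shows "h x m s = h x s m"
proof -
  have "h x m s = (\<Sum>a\<in>UNIV. \<Sum>b\<in>UNIV. h x m a * G x [a, b] * h x s b)"
  proof -
    have "(\<Sum>b\<in>UNIV. G x [a, b] * h x s b) = (if s = a then 1 else 0)" for a
      using h_metric(1)[OF assms, of s a] by (simp add: metric_sym[OF assms, of a] mult.commute)
    then show ?thesis
      by (simp add: mult.assoc if_distrib[of "\<lambda>t. _ * t"] cong: if_cong flip: sum_distrib_left)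
  qed
  also have "\<dots> = (\<Sum>b\<in>UNIV. (\<Sum>a\<in>UNIV. h x m a * G x [a, b]) * h x s b)"
    by (subst sum.swap) (simp add: sum_distrib_right)
  also have "\<dots> = h x s m"
    by (simp add: h_metric(1)[OF assms] if_distrib[of "\<lambda>t. t * _"] cong: if_cong)
  finally show ?thesis .
qed

lemma smooth_h: "smooth_on (\<lambda>x. h x m s) U"
  unfolding metric_inv_def
  by (rule smooth_on_matrix_inv[OF open_U _ metric_invertible]) (simp_all add: smooth_metric)

lemma smooth_christoffel: "smooth_on (\<Gamma> m k l) U"
proof -
  have "smooth_on (\<lambda>x. (\<Sum>s\<in>UNIV. h x m s *
        (pd k (\<lambda>y. G y [s, l]) x + pd l (\<lambda>y. G y [k, s]) x - pd s (\<lambda>y. G y [k, l]) x)) * (1 / 2)) U"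
    by (intro smooth_on_mult smooth_on_sum smooth_on_diff smooth_on_add smooth_on_const smooth_on_pd
        open_U smooth_h smooth_metric)
  then show ?thesis
    by (simp add: christoffel_def[abs_def])
qed

lemma pd_metric_sym: "x \<in> U \<Longrightarrow> pd k (\<lambda>y. G y [i, j]) x = pd k (\<lambda>y. G y [j, i]) x"
  by (rule pd_cong[OF open_U]) (auto intro: metric_sym)

lemma christoffel_sym: "x \<in> U \<Longrightarrow> \<Gamma> m k l x = \<Gamma> m l k x"
  unfolding christoffel_def using pd_metric_sym[of x]
  by (intro arg_cong[of _ _ "\<lambda>t. t / 2"] sum.cong refl) (metis add.commute)

lemma pd_christoffel_sym: "x \<in> U \<Longrightarrow> pd i (\<Gamma> m k l) x = pd i (\<Gamma> m l k) x"
  by (rule pd_cong[OF open_U]) (auto intro: christoffel_sym)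

lemma smooth_nabla:
  assumes "\<And>ls. length ls = r \<Longrightarrow> smooth_on (\<lambda>y. T y ls) U" "length ls = Suc r"
  shows "smooth_on (\<lambda>y. nabla G T y ls) U"
proof -
  obtain k ms where ls: "ls = k # ms" "length ms = r"
    using assms(2) by (cases ls) auto
  show ?thesis
    unfolding ls nabla.simps
    by (intro smooth_on_diff smooth_on_sum smooth_on_mult smooth_on_pd smooth_christoffel open_U assms(1))
      (auto simp: ls)
qed

lemma smooth_riemann: "smooth_on (\<lambda>x. Ru x i k l m) U"
  unfolding riemann_def
  by (intro smooth_on_diff smooth_on_add smooth_on_sum smooth_on_mult smooth_on_pd smooth_christoffel open_U)

lemma smooth_riemann_low: "length ls = 4 \<Longrightarrow> smooth_on (\<lambda>x. riemann_low G x ls) U"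
  unfolding riemann_low_def
  by (intro smooth_on_sum smooth_on_mult smooth_riemann smooth_metric open_U)

lemma smooth_ricci: "smooth_on (\<lambda>x. ricci G x ls) U"
  unfolding ricci_def
  by (intro smooth_on_sum smooth_on_minus smooth_riemann open_U)

text \<open>The terms are grouped by their behaviour under exchange of \<open>i\<close> and
  \<open>k\<close>: the first is symmetric because partial derivatives commute, the second and fifth
  are exchanged, the fourth is symmetric because \<open>\<Gamma>\<close> is. Only the third and
  sixth survive antisymmetrisation and build the curvature.\<close>

lemma nabla_nabla:
  assumes "\<And>ls. length ls = r \<Longrightarrow> smooth_on (\<lambda>y. T y ls) U" "x \<in> U" "length ls = r"
  shows "nabla G (nabla G T) x (i # k # ls) =
      pd i (pd k (\<lambda>y. T y ls)) x
      - (\<Sum>a<r. \<Sum>s\<in>UNIV. \<Gamma> s k (ls ! a) x * pd i (\<lambda>y. T y (ls[a := s])) x)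
      - (\<Sum>a<r. \<Sum>s\<in>UNIV. pd i (\<Gamma> s k (ls ! a)) x * T x (ls[a := s]))
      - (\<Sum>s\<in>UNIV. \<Gamma> s i k x * nabla G T x (s # ls))
      - (\<Sum>a<r. \<Sum>s\<in>UNIV. \<Gamma> s i (ls ! a) x * pd k (\<lambda>y. T y (ls[a := s])) x)
      + (\<Sum>a<r. \<Sum>s\<in>UNIV. \<Gamma> s i (ls ! a) x *
          (\<Sum>b<r. \<Sum>t\<in>UNIV. \<Gamma> t k (ls[a := s] ! b) x * T x (ls[a := s, b := t])))"
proof -
  have smooth_T: "smooth_on (\<lambda>y. T y (ls[a := s])) U" for a s
    by (rule assms(1)) (simp add: assms(3))
  have "pd i (\<lambda>y. nabla G T y (k # ls)) x =
      pd i (pd k (\<lambda>y. T y ls)) x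
      - (\<Sum>a<r. \<Sum>s\<in>UNIV. \<Gamma> s k (ls ! a) x * pd i (\<lambda>y. T y (ls[a := s])) x
          + pd i (\<Gamma> s k (ls ! a)) x * T x (ls[a := s]))"
  proof -
    have sm: "smooth_on (\<lambda>y. \<Gamma> s k (ls ! a) y * T y (ls[a := s])) U" for a s
      by (intro smooth_on_mult open_U smooth_christoffel smooth_T)
    have "pd i (\<lambda>y. nabla G T y (k # ls)) x = pd i (pd k (\<lambda>y. T y ls)) x
        - pd i (\<lambda>y. \<Sum>a<r. \<Sum>s\<in>UNIV. \<Gamma> s k (ls ! a) y * T y (ls[a := s])) x"
      unfolding nabla.simps assms(3)
      by (intro pd_diff diff_at[OF _ assms(2)] smooth_on_sum sm smooth_on_pd assms open_U)
    also have "pd i (\<lambda>y. \<Sum>a<r. \<Sum>s\<in>UNIV. \<Gamma> s k (ls ! a) y * T y (ls[a := s])) x =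
        (\<Sum>a<r. \<Sum>s\<in>UNIV. pd i (\<lambda>y. \<Gamma> s k (ls ! a) y * T y (ls[a := s])) x)"
      by (simp add: pd_sum diff_at[OF sm assms(2)] diff_at[OF smooth_on_sum[OF open_U sm] assms(2)])
    also have "\<dots> = (\<Sum>a<r. \<Sum>s\<in>UNIV. \<Gamma> s k (ls ! a) x * pd i (\<lambda>y. T y (ls[a := s])) x
          + pd i (\<Gamma> s k (ls ! a)) x * T x (ls[a := s]))"
      by (intro sum.cong refl pd_mult diff_at[OF _ assms(2)] smooth_christoffel smooth_T)
    finally show ?thesis .
  qed
  \<comment> \<open>Slot 0 of \<open>nabla G T\<close> is its differentiation index
    \<open>k\<close>; \<open>sum.lessThan_Suc_shift\<close> separates it from the slots of
    \<open>ls\<close>.\<close>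
  moreover have "nabla G (nabla G T) x (i # k # ls) = pd i (\<lambda>y. nabla G T y (k # ls)) x
      - ((\<Sum>s\<in>UNIV. \<Gamma> s i k x * nabla G T x (s # ls))
       + (\<Sum>a<r. \<Sum>s\<in>UNIV. \<Gamma> s i (ls ! a) x * nabla G T x (k # ls[a := s])))"
    unfolding nabla.simps(1)[of G "nabla G T" x i "k # ls"] length_Cons assms(3) sum.lessThan_Suc_shift
    by (simp del: nabla.simps)
  ultimately show ?thesis
    by (simp add: assms(3) sum.distrib sum_subtractf right_diff_distrib)
qed

text \<open>Products of two Christoffel symbols split into \<open>N1\<close>, where both act on the
  same slot, and \<open>N2\<close>, where they act on different slots. \<open>N2\<close> is
  symmetric in \<open>i\<close> and \<open>k\<close> since updates of different slots commute;
  \<open>N1\<close> and the derivative terms \<open>Q\<close> assemble the curvature.\<close>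

theorem ricci_identity:
  assumes "\<And>ls. length ls = r \<Longrightarrow> smooth_on (\<lambda>y. T y ls) U" "x \<in> U" "length ls = r"
  shows "nabla G (nabla G T) x (i # k # ls) - nabla G (nabla G T) x (k # i # ls) =
    (\<Sum>a<r. \<Sum>s\<in>UNIV. Ru x i k (ls ! a) s * T x (ls[a := s]))"
proof -
  define Q where "Q i k = (\<Sum>a<r. \<Sum>s\<in>UNIV. pd i (\<Gamma> s k (ls ! a)) x * T x (ls[a := s]))" for i k
  define N where "N i k = (\<Sum>a<r. \<Sum>s\<in>UNIV. \<Gamma> s i (ls ! a) x *
      (\<Sum>b<r. \<Sum>t\<in>UNIV. \<Gamma> t k (ls[a := s] ! b) x * T x (ls[a := s, b := t])))" for i k
  define N1 where "N1 i k = (\<Sum>a<r. \<Sum>t\<in>UNIV. (\<Sum>s\<in>UNIV. \<Gamma> s i (ls ! a) x * \<Gamma> t k s x) * T x (ls[a := t]))" for i k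
  define N2 where "N2 i k = (\<Sum>a<r. \<Sum>b<r. if a = b then 0 else
      \<Sum>s\<in>UNIV. \<Sum>t\<in>UNIV. \<Gamma> s i (ls ! a) x * \<Gamma> t k (ls ! b) x * T x (ls[a := s, b := t]))" for i k
  have N: "N i k = N1 i k + N2 i k" for i k
  proof -
    \<comment> \<open>In the case \<open>a = b\<close> the second update overwrites the first, and
      the index met by the second symbol is the freshly written \<open>s\<close>.\<close>
    have inner: "(\<Sum>b<r. \<Sum>t\<in>UNIV. \<Gamma> t k (ls[a := s] ! b) x * T x (ls[a := s, b := t])) =
        (\<Sum>t\<in>UNIV. \<Gamma> t k s x * T x (ls[a := t])) +
        (\<Sum>b<r. if a = b then 0 else \<Sum>t\<in>UNIV. \<Gamma> t k (ls ! b) x * T x (ls[a := s, b := t]))"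
      if "a < r" for a s
    proof -
      have "(\<Sum>b<r. \<Sum>t\<in>UNIV. \<Gamma> t k (ls[a := s] ! b) x * T x (ls[a := s, b := t])) =
        (\<Sum>b<r. (if a = b then \<Sum>t\<in>UNIV. \<Gamma> t k s x * T x (ls[a := t]) else 0) +
          (if a = b then 0 else \<Sum>t\<in>UNIV. \<Gamma> t k (ls ! b) x * T x (ls[a := s, b := t])))"
        by (rule sum.cong) (use that assms(3) in auto)
      then show ?thesis using that by (simp add: sum.distrib)
    qed
    have "N i k = (\<Sum>a<r. \<Sum>s\<in>UNIV. \<Gamma> s i (ls ! a) x * (\<Sum>t\<in>UNIV. \<Gamma> t k s x * T x (ls[a := t])))
      + (\<Sum>a<r. \<Sum>s\<in>UNIV. \<Gamma> s i (ls ! a) x *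
        (\<Sum>b<r. if a = b then 0 else \<Sum>t\<in>UNIV. \<Gamma> t k (ls ! b) x * T x (ls[a := s, b := t])))"
      unfolding N_def by (simp add: inner distrib_left sum.distrib)
    moreover have "(\<Sum>s\<in>UNIV. \<Gamma> s i (ls ! a) x * (\<Sum>t\<in>UNIV. \<Gamma> t k s x * T x (ls[a := t])))
       = (\<Sum>t\<in>UNIV. (\<Sum>s\<in>UNIV. \<Gamma> s i (ls ! a) x * \<Gamma> t k s x) * T x (ls[a := t]))" for a
      by (simp add: sum_distrib_left sum_distrib_right mult.assoc) (rule sum.swap)
    moreover have "(\<Sum>s\<in>UNIV. \<Gamma> s i (ls ! a) x *
        (\<Sum>b<r. if a = b then 0 else \<Sum>t\<in>UNIV. \<Gamma> t k (ls ! b) x * T x (ls[a := s, b := t])))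
      = (\<Sum>b<r. if a = b then 0 else
      \<Sum>s\<in>UNIV. \<Sum>t\<in>UNIV. \<Gamma> s i (ls ! a) x * \<Gamma> t k (ls ! b) x * T x (ls[a := s, b := t]))" for a
      unfolding sum_distrib_left
      by (subst sum.swap, rule sum.cong) (auto simp: sum_distrib_left mult.assoc)
    ultimately show ?thesis by (simp add: N1_def N2_def)
  qed
  have N2: "N2 i k = N2 k i"
  proof -
    have "N2 i k = (\<Sum>b<r. \<Sum>a<r. if a = b then 0 else
      \<Sum>s\<in>UNIV. \<Sum>t\<in>UNIV. \<Gamma> s i (ls ! a) x * \<Gamma> t k (ls ! b) x * T x (ls[a := s, b := t]))"
      unfolding N2_def by (rule sum.swap)
    also have "\<dots> = (\<Sum>b<r. \<Sum>a<r. if b = a then 0 else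
      \<Sum>t\<in>UNIV. \<Sum>s\<in>UNIV. \<Gamma> t k (ls ! b) x * \<Gamma> s i (ls ! a) x * T x (ls[b := t, a := s]))"
    proof (intro sum.cong refl)
      fix a b :: nat
      have "b \<noteq> a \<Longrightarrow> (\<Sum>s\<in>UNIV. \<Sum>t\<in>UNIV. \<Gamma> s i (ls ! a) x * \<Gamma> t k (ls ! b) x * T x (ls[a := s, b := t])) =
          (\<Sum>t\<in>UNIV. \<Sum>s\<in>UNIV. \<Gamma> t k (ls ! b) x * \<Gamma> s i (ls ! a) x * T x (ls[b := t, a := s]))"
        by (subst sum.swap) (simp add: list_update_swap mult.commute)
      then show "(if a = b then 0 else \<Sum>s\<in>UNIV. \<Sum>t\<in>UNIV. \<Gamma> s i (ls ! a) x * \<Gamma> t k (ls ! b) x * T x (ls[a := s, b := t])) =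
          (if b = a then 0 else \<Sum>t\<in>UNIV. \<Sum>s\<in>UNIV. \<Gamma> t k (ls ! b) x * \<Gamma> s i (ls ! a) x * T x (ls[b := t, a := s]))"
        by simp
    qed
    finally show ?thesis unfolding N2_def .
  qed
  have "nabla G (nabla G T) x (i # k # ls) - nabla G (nabla G T) x (k # i # ls)
      = Q k i - Q i k + N i k - N k i"
    using nabla_nabla[where T = T, OF assms, of i k] nabla_nabla[where T = T, OF assms, of k i]
      pd_commute[OF open_U assms(1)[OF assms(3)] assms(2), of i k]
    by (simp add: christoffel_sym[OF assms(2), of _ i k] Q_def N_def del: nabla.simps)
  also have "\<dots> = Q k i - Q i k + N1 i k - N1 k i"
    by (simp add: N N2)
  also have "\<dots> = (\<Sum>a<r. \<Sum>s\<in>UNIV. Ru x i k (ls ! a) s * T x (ls[a := s]))"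
    unfolding Q_def N1_def riemann_def
    by (simp add: sum_subtractf sum.distrib algebra_simps sum_distrib_right sum_distrib_left)
  finally show ?thesis .
qed

end

lemma sum_delta_mult [simp]:
  fixes f :: "'n::finite \<Rightarrow> real"
  shows "(\<Sum>s\<in>UNIV. (if m = s then 1 else 0) * f s) = f m"
    and "(\<Sum>s\<in>UNIV. (if s = m then 1 else 0) * f s) = f m"
    and "(\<Sum>s\<in>UNIV. f s * (if m = s then 1 else 0)) = f m"
    and "(\<Sum>s\<in>UNIV. f s * (if s = m then 1 else 0)) = f m"
  by (simp_all add: if_distrib[of "\<lambda>t. t * _"] if_distrib[of "\<lambda>t. _ * t"] cong: if_cong)

section \<open>Symmetries and contractions of the curvature\<close>

context metric_chart
begin

section \<open>Metric compatibility and the symmetries of the curvature\<close>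

lemma ricci_identity_2:
  assumes "\<And>ls. length ls = 2 \<Longrightarrow> smooth_on (\<lambda>y. T y ls) U" "x \<in> U"
  shows "nabla G (nabla G T) x [i, k, a, b] - nabla G (nabla G T) x [k, i, a, b] =
    (\<Sum>s\<in>UNIV. Ru x i k a s * T x [s, b]) + (\<Sum>s\<in>UNIV. Ru x i k b s * T x [a, s])"
  by (subst ricci_identity[where T = T and r = 2, OF assms]) (simp_all add: numeral_2_eq_2)

lemma ricci_identity_4:
  assumes "\<And>ls. length ls = 4 \<Longrightarrow> smooth_on (\<lambda>y. T y ls) U" "x \<in> U"
  shows "nabla G (nabla G T) x [i, k, a, b, c, d] - nabla G (nabla G T) x [k, i, a, b, c, d] =
    (\<Sum>s\<in>UNIV. Ru x i k a s * T x [s, b, c, d]) + (\<Sum>s\<in>UNIV. Ru x i k b s * T x [a, s, c, d])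
    + (\<Sum>s\<in>UNIV. Ru x i k c s * T x [a, b, s, d]) + (\<Sum>s\<in>UNIV. Ru x i k d s * T x [a, b, c, s])"
  by (subst ricci_identity[where T = T and r = 4, OF assms]) (simp_all add: eval_nat_numeral)

text \<open>Lowering the index undoes the inverse metric in \<open>christoffel\<close> and leaves
  the Christoffel symbols of the first kind.\<close>

lemma christoffel_low:
  assumes "x \<in> U"
  shows "(\<Sum>s\<in>UNIV. \<Gamma> s k l x * G x [s, m]) =
    (pd k (\<lambda>y. G y [m, l]) x + pd l (\<lambda>y. G y [k, m]) x - pd m (\<lambda>y. G y [k, l]) x) / 2"
proof -
  let ?D = "\<lambda>t. pd k (\<lambda>y. G y [t, l]) x + pd l (\<lambda>y. G y [k, t]) x - pd t (\<lambda>y. G y [k, l]) x"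
  have "(\<Sum>s\<in>UNIV. \<Gamma> s k l x * G x [s, m]) = (\<Sum>s\<in>UNIV. \<Sum>t\<in>UNIV. G x [m, s] * h x s t * (?D t / 2))"
    unfolding christoffel_def
    by (simp add: sum_divide_distrib sum_distrib_right sum_distrib_left metric_sym[OF assms, of _ m] mult_ac)
  also have "\<dots> = (\<Sum>t\<in>UNIV. (\<Sum>s\<in>UNIV. G x [m, s] * h x s t) * (?D t / 2))"
    by (subst sum.swap) (simp only: sum_distrib_right)
  also have "\<dots> = ?D m / 2"
    unfolding h_metric(2)[OF assms] by (rule sum_delta_mult)
  finally show ?thesis .
qed

text \<open>The lowered symbols of the two slots add up to the partial derivative of the metric, the
  other derivatives cancelling by symmetry.\<close>

lemma nabla_metric:
  assumes "x \<in> U"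
  shows "nabla G G x [k, a, b] = 0"
proof -
  have "(\<Sum>s\<in>UNIV. \<Gamma> s k b x * G x [a, s]) = (\<Sum>s\<in>UNIV. \<Gamma> s k b x * G x [s, a])"
    by (simp add: metric_sym[OF assms, of a])
  then show ?thesis
    unfolding nabla_2
    using christoffel_low[OF assms, of k a b] christoffel_low[OF assms, of k b a]
      pd_metric_sym[OF assms, of k a b] pd_metric_sym[OF assms, of b a k] pd_metric_sym[OF assms, of a k b]
    by (simp add: field_simps)
qed

lemma nabla_nabla_metric:
  assumes "x \<in> U"
  shows "nabla G (nabla G G) x [i, k, a, b] = 0"
proof -
  have "nabla G (nabla G G) x [i, k, a, b] = nabla G (\<lambda>y ls. 0) x [i, k, a, b]"
  proof (rule nabla_cong[OF open_U assms, where r = 3])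
    fix y ls assume "y \<in> U" "length (ls :: 'n list) = 3"
    then show "nabla G G y ls = 0"
      using nabla_metric by (auto simp: length_Suc_conv numeral_3_eq_3 simp del: nabla.simps)
  qed simp
  then show ?thesis by (simp add: nabla_3)
qed

lemma riemann_low_eq: "Rm x i k l m = (\<Sum>s\<in>UNIV. Ru x i k l s * G x [s, m])"
  by (simp add: riemann_low_def numeral_2_eq_2 numeral_3_eq_3)

lemma riemann_eq:
  assumes "x \<in> U"
  shows "Ru x i k l m = (\<Sum>p\<in>UNIV. Rm x i k l p * h x p m)"
proof -
  have "(\<Sum>p\<in>UNIV. Rm x i k l p * h x p m) = (\<Sum>s\<in>UNIV. Ru x i k l s * (\<Sum>p\<in>UNIV. G x [s, p] * h x p m))"
    by (simp add: riemann_low_eq sum_distrib_left sum_distrib_right mult.assoc) (rule sum.swap)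
  then show ?thesis
    by (simp only: h_metric(2)[OF assms] sum_delta_mult)
qed

lemma riemann_antisym: "Ru x i k l m = - Ru x k i l m"
  by (simp add: riemann_def sum_subtractf)

text \<open>Absence of torsion: by symmetry of \<open>\<Gamma>\<close> in its lower indices all
  derivatives and all quadratic terms cancel in pairs.\<close>

lemma first_bianchi:
  assumes "x \<in> U"
  shows "Ru x i k l m + Ru x k l i m + Ru x l i k m = 0"
  unfolding riemann_def
  by (simp add: sum_subtractf pd_christoffel_sym[OF assms, of _ _ l] pd_christoffel_sym[OF assms, of _ _ k i]
      christoffel_sym[OF assms, of _ l i] christoffel_sym[OF assms, of _ l k] christoffel_sym[OF assms, of _ k i])

lemma Rm_antisym12: "Rm x i k l m = - Rm x k i l m"
  unfolding riemann_low_eq riemann_antisym[of _ i] by (simp add: sum_negf)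

lemma Rm_bianchi:
  assumes "x \<in> U"
  shows "Rm x i k l m + Rm x k l i m + Rm x l i k m = 0"
  unfolding riemann_low_eq sum.distrib[symmetric] distrib_right[symmetric] first_bianchi[OF assms] by simp

text \<open>The Ricci identity for the metric itself, whose second covariant derivatives
  vanish.\<close>

lemma Rm_antisym34:
  assumes "x \<in> U"
  shows "Rm x i k l m = - Rm x i k m l"
proof -
  have "smooth_on (\<lambda>y. G y ls) U" if "length ls = 2" for ls
    using that smooth_metric by (auto simp: length_Suc_conv numeral_2_eq_2)
  from ricci_identity_2[where T = G, OF this assms, of i k l m]
  show ?thesis
    unfolding riemann_low_eq nabla_nabla_metric[OF assms]
    by (simp add: metric_sym[OF assms, of l])
qed

text \<open>The classical octahedron argument: four Bianchi identities, each index standing last in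
  one of them, are combined linearly using both antisymmetries.\<close>

lemma Rm_pair_sym:
  assumes "x \<in> U"
  shows "Rm x i k l m = Rm x l m i k"
  using Rm_bianchi[OF assms, of i k l m] Rm_bianchi[OF assms, of k l m i]
    Rm_bianchi[OF assms, of l m i k] Rm_bianchi[OF assms, of m i k l]
    Rm_antisym34[OF assms, of k l i m] Rm_antisym34[OF assms, of l i k m]
    Rm_antisym34[OF assms, of i k l m] Rm_antisym34[OF assms, of l m k i]
    Rm_antisym34[OF assms, of m k l i] Rm_antisym34[OF assms, of m i k l] Rm_antisym34[OF assms, of i l m k] 
    Rm_antisym34[OF assms, of k m i l] 
    Rm_antisym12[of x l i k m] Rm_antisym12[of x m k l i] Rm_antisym12[of x m i l k] Rm_antisym12[of x m i k l]
    Rm_antisym12[of x i l m k] Rm_antisym12[of x i l k m] Rm_antisym12[of x k m l i] Rm_antisym12[of x k m i l]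
  by linarith

lemma ricci_eq:
  assumes "x \<in> U"
  shows "(\<Sum>j\<in>UNIV. \<Sum>m\<in>UNIV. h x j m * Rm x j k l m) = - Rc x k l"
  unfolding ricci_def by (simp add: riemann_eq[OF assms] h_sym[OF assms, of _ _] mult.commute)

text \<open>Pair symmetry and the two antisymmetries together reverse the order of the four indices,
  which exchanges \<open>k\<close> and \<open>l\<close> and also the two contracted slots.\<close>

lemma ricci_sym:
  assumes "x \<in> U"
  shows "Rc x k l = Rc x l k"
proof -
  have "- Rc x k l = (\<Sum>m\<in>UNIV. \<Sum>j\<in>UNIV. h x j m * Rm x j k l m)"
    unfolding ricci_eq[OF assms, symmetric] by (rule sum.swap)
  also have "\<dots> = (\<Sum>m\<in>UNIV. \<Sum>j\<in>UNIV. h x m j * Rm x m l k j)"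
  proof (intro sum.cong refl)
    fix m j
    have "Rm x j k l m = Rm x m l k j"
      using Rm_pair_sym[OF assms, of j k l m] Rm_antisym12[of x l m j k] Rm_antisym34[OF assms, of m l j k]
      by simp
    then show "h x j m * Rm x j k l m = h x m j * Rm x m l k j"
      by (simp add: h_sym[OF assms, of j])
  qed
  also have "\<dots> = - Rc x l k" by (rule ricci_eq[OF assms])
  finally show ?thesis by simp
qed

text \<open>\<open>RicR x a b c d\<close> is \<open>R\<^sub>a\<^sup>m R\<^sub>b\<^sub>c\<^sub>d\<^sub>m\<close>.\<close>

definition RicR where
  "RicR x a b c d = (\<Sum>m\<in>UNIV. (\<Sum>j\<in>UNIV. h x j m * Rc x j a) * Rm x b c d m)"

text \<open>The obstruction called \<open>C\<close> in the overview; \<open>l\<close> stays fixed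
  while the other three indices rotate.\<close>

definition cycRicR where
  "cycRicR x s i k l = RicR x s i k l + RicR x i k s l + RicR x k s i l"

section \<open>Contractions of curvature with the Ricci tensor and the metric\<close>

lemma RicR_antisym: "RicR x a b c d = - RicR x a c b d"
  unfolding RicR_def Rm_antisym12[of x b c] by (simp add: sum_negf)

lemma RicR_bianchi:
  assumes "x \<in> U"
  shows "RicR x a b c d + RicR x a c d b + RicR x a d b c = 0"
  unfolding RicR_def sum.distrib[symmetric] distrib_left[symmetric] Rm_bianchi[OF assms] by simp

text \<open>The link from the mixed-index terms that the Ricci identity delivers to
  \<open>RicR\<close>.\<close>

lemma riemann_ricci:
  assumes "x \<in> U"
  shows "(\<Sum>p\<in>UNIV. Ru x b c d p * Rc x a p) = RicR x a b c d"
proof -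
  have "(\<Sum>p\<in>UNIV. Ru x b c d p * Rc x a p) = (\<Sum>p\<in>UNIV. \<Sum>m\<in>UNIV. h x p m * Rc x p a * Rm x b c d m)"
    unfolding riemann_eq[OF assms] sum_distrib_right
    by (intro sum.cong refl) (simp add: h_sym[OF assms] ricci_sym[OF assms, of a] mult_ac)
  also have "\<dots> = RicR x a b c d"
    unfolding RicR_def by (subst sum.swap) (simp add: sum_distrib_right)
  finally show ?thesis .
qed

text \<open>The curvature operator annihilates the metric, so its actions on the two slots
  contracted with each other cancel.\<close>

lemma contract_riemann_outer:
  assumes "x \<in> U"
  shows "(\<Sum>j\<in>UNIV. \<Sum>m\<in>UNIV. h x j m * (\<Sum>p\<in>UNIV. Ru x s i j p * Rm x p k l m))
     + (\<Sum>j\<in>UNIV. \<Sum>m\<in>UNIV. h x j m * (\<Sum>p\<in>UNIV. Ru x s i m p * Rm x j k l p)) = 0"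
proof -
  \<comment> \<open>\<open>E m p\<close> is the curvature with both final indices raised; it
    inherits antisymmetry from \<open>Rm_antisym34\<close>.\<close>
  define E where "E m p = (\<Sum>j\<in>UNIV. h x j m * Ru x s i j p)" for m p
  have E: "E m p = - E p m" for m p
  proof -
    have "E m p = (\<Sum>j\<in>UNIV. \<Sum>q\<in>UNIV. h x j m * h x p q * Rm x s i j q)"
      unfolding E_def riemann_eq[OF assms] by (simp add: sum_distrib_left h_sym[OF assms, of p] mult_ac)
    also have "\<dots> = (\<Sum>q\<in>UNIV. \<Sum>j\<in>UNIV. - (h x q p * h x m j * Rm x s i q j))"
      by (subst sum.swap) (intro sum.cong refl, subst Rm_antisym34[OF assms],
          simp add: h_sym[OF assms, of p] h_sym[OF assms, of m] mult_ac)
    also have "\<dots> = - E p m"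
      unfolding E_def riemann_eq[OF assms] by (simp add: sum_distrib_left h_sym[OF assms, of m] mult_ac sum_negf)
    finally show ?thesis .
  qed
  have "(\<Sum>j\<in>UNIV. \<Sum>m\<in>UNIV. h x j m * (\<Sum>p\<in>UNIV. Ru x s i j p * Rm x p k l m))
      = (\<Sum>m\<in>UNIV. \<Sum>p\<in>UNIV. E m p * Rm x p k l m)"
  proof -
    have "(\<Sum>j\<in>UNIV. h x j m * (\<Sum>p\<in>UNIV. Ru x s i j p * Rm x p k l m)) = (\<Sum>p\<in>UNIV. E m p * Rm x p k l m)" for m
      unfolding E_def sum_distrib_left sum_distrib_right by (subst sum.swap) (simp add: mult.assoc)
    then show ?thesis by (subst sum.swap) simp
  qed
  moreover have "(\<Sum>j\<in>UNIV. \<Sum>m\<in>UNIV. h x j m * (\<Sum>p\<in>UNIV. Ru x s i m p * Rm x j k l p))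
      = (\<Sum>p\<in>UNIV. \<Sum>m\<in>UNIV. E p m * Rm x p k l m)"
  proof -
    have "(\<Sum>m\<in>UNIV. h x j m * (\<Sum>p\<in>UNIV. Ru x s i m p * Rm x j k l p)) = (\<Sum>p\<in>UNIV. E j p * Rm x j k l p)" for j
      unfolding E_def sum_distrib_left sum_distrib_right
      by (subst sum.swap) (simp add: mult.assoc h_sym[OF assms, of j])
    then show ?thesis by simp
  qed
  moreover have "(\<Sum>m\<in>UNIV. \<Sum>p\<in>UNIV. E m p * Rm x p k l m) = - (\<Sum>p\<in>UNIV. \<Sum>m\<in>UNIV. E p m * Rm x p k l m)"
    by (subst sum.swap, subst E) (simp add: sum_negf)
  ultimately show ?thesis by simp
qed

text \<open>For the terms where the curvature acts on an uncontracted slot; \<open>f\<close> will be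
  \<open>Ru x s i k\<close> or \<open>Ru x s i l\<close>.\<close>

lemma contract_riemann_mid:
  assumes "x \<in> U"
  shows "(\<Sum>j\<in>UNIV. \<Sum>m\<in>UNIV. h x j m * (\<Sum>p\<in>UNIV. f p * Rm x j p l m)) = - (\<Sum>p\<in>UNIV. f p * Rc x p l)"
    and "(\<Sum>j\<in>UNIV. \<Sum>m\<in>UNIV. h x j m * (\<Sum>p\<in>UNIV. f p * Rm x j k p m)) = - (\<Sum>p\<in>UNIV. f p * Rc x k p)"
proof -
  have swap: "(\<Sum>j\<in>UNIV. \<Sum>m\<in>UNIV. h x j m * (\<Sum>p\<in>UNIV. f p * H j p m))
      = (\<Sum>p\<in>UNIV. f p * (\<Sum>j\<in>UNIV. \<Sum>m\<in>UNIV. h x j m * H j p m))" for H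
  proof -
    have "(\<Sum>j\<in>UNIV. \<Sum>m\<in>UNIV. h x j m * (\<Sum>p\<in>UNIV. f p * H j p m))
      = (\<Sum>j\<in>UNIV. \<Sum>p\<in>UNIV. \<Sum>m\<in>UNIV. f p * (h x j m * H j p m))"
      unfolding sum_distrib_left by (intro sum.cong refl trans[OF sum.swap]) (simp add: mult_ac)
    also have "\<dots> = (\<Sum>p\<in>UNIV. \<Sum>j\<in>UNIV. \<Sum>m\<in>UNIV. f p * (h x j m * H j p m))"
      by (rule sum.swap)
    finally show ?thesis by (simp add: sum_distrib_left)
  qed
  show "(\<Sum>j\<in>UNIV. \<Sum>m\<in>UNIV. h x j m * (\<Sum>p\<in>UNIV. f p * Rm x j p l m)) = - (\<Sum>p\<in>UNIV. f p * Rc x p l)"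
    "(\<Sum>j\<in>UNIV. \<Sum>m\<in>UNIV. h x j m * (\<Sum>p\<in>UNIV. f p * Rm x j k p m)) = - (\<Sum>p\<in>UNIV. f p * Rc x k p)"
    unfolding swap ricci_eq[OF assms] by (simp_all add: sum_negf)
qed

text \<open>The three shapes of term that occur when the right-hand side of the pseudosymmetry
  condition is traced over \<open>j\<close> and \<open>m\<close>.\<close>

lemma contract_ricci_riemann:
  assumes "x \<in> U"
  shows "(\<Sum>j\<in>UNIV. \<Sum>m\<in>UNIV. h x j m * (Rc x j s * Rm x i k l m)) = RicR x s i k l"
    and "(\<Sum>j\<in>UNIV. \<Sum>m\<in>UNIV. h x j m * (c * Rm x j k l m)) = - (c * Rc x k l)"
    and "(\<Sum>j\<in>UNIV. \<Sum>m\<in>UNIV. h x j m * (Rc x m s * Rm x j k l i)) = - RicR x s l i k"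
proof -
  show "(\<Sum>j\<in>UNIV. \<Sum>m\<in>UNIV. h x j m * (Rc x j s * Rm x i k l m)) = RicR x s i k l"
    unfolding RicR_def by (subst sum.swap) (simp add: sum_distrib_right mult.assoc)
  have "(\<Sum>j\<in>UNIV. \<Sum>m\<in>UNIV. h x j m * (c * Rm x j k l m)) = c * (\<Sum>j\<in>UNIV. \<Sum>m\<in>UNIV. h x j m * Rm x j k l m)"
    by (simp add: sum_distrib_left mult_ac)
  then show "(\<Sum>j\<in>UNIV. \<Sum>m\<in>UNIV. h x j m * (c * Rm x j k l m)) = - (c * Rc x k l)"
    unfolding ricci_eq[OF assms] by simp
  have "Rm x j k l i = - Rm x l i k j" for j
    using Rm_pair_sym[OF assms, of j k l i] Rm_antisym34[OF assms, of l i j k] by simp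
  then show "(\<Sum>j\<in>UNIV. \<Sum>m\<in>UNIV. h x j m * (Rc x m s * Rm x j k l i)) = - RicR x s l i k"
    unfolding RicR_def by (simp add: sum_distrib_right sum_negf mult.assoc h_sym[OF assms])
qed


text \<open>Trace over the outer slots \<open>j\<close> and \<open>m\<close>. On the left the Ricci
  identity leaves only its two middle terms; on the right the four products of two Ricci tensors
  cancel by symmetry.\<close>

lemma contracted_pseudosymmetry:
  assumes "x \<in> U"
    and pseudosym: "\<And>j m. nabla G (nabla G (riemann_low G)) x [s, i, j, k, l, m]
           - nabla G (nabla G (riemann_low G)) x [i, s, j, k, l, m] =
           c * (Rc x j s * Rm x i k l m - Rc x j i * Rm x s k l m
            + Rc x k s * Rm x j i l m - Rc x k i * Rm x j s l m
            + Rc x l s * Rm x j k i m - Rc x l i * Rm x j k s m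
            + Rc x m s * Rm x j k l i - Rc x m i * Rm x j k l s)"
  shows "- RicR x l s i k - RicR x k s i l
    = c * (RicR x s i k l - RicR x i s k l - RicR x s l i k + RicR x i l s k)"
proof -
  let ?tr = "\<lambda>F :: 'n \<Rightarrow> 'n \<Rightarrow> real. \<Sum>j\<in>UNIV. \<Sum>m\<in>UNIV. h x j m * F j m"
  note id = ricci_identity_4[where T = "riemann_low G", OF smooth_riemann_low assms(1)]
  have tr_add: "?tr (\<lambda>j m. F j m + H j m) = ?tr F + ?tr H"
    and tr_diff: "?tr (\<lambda>j m. F j m - H j m) = ?tr F - ?tr H"
    and tr_mult: "?tr (\<lambda>j m. c * F j m) = c * ?tr F" for F H
    by (simp_all add: distrib_left right_diff_distrib sum.distrib sum_subtractf sum_distrib_left mult_ac)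
  have "?tr (\<lambda>j m. (\<Sum>p\<in>UNIV. Ru x s i j p * Rm x p k l m) + (\<Sum>p\<in>UNIV. Ru x s i k p * Rm x j p l m)
    + (\<Sum>p\<in>UNIV. Ru x s i l p * Rm x j k p m) + (\<Sum>p\<in>UNIV. Ru x s i m p * Rm x j k l p))
    = ?tr (\<lambda>j m. c * (Rc x j s * Rm x i k l m - Rc x j i * Rm x s k l m
            + Rc x k s * Rm x j i l m - Rc x k i * Rm x j s l m
            + Rc x l s * Rm x j k i m - Rc x l i * Rm x j k s m
            + Rc x m s * Rm x j k l i - Rc x m i * Rm x j k l s))"
    by (intro arg_cong[of _ _ ?tr] ext trans[OF id[symmetric] pseudosym])
  then show ?thesis
    unfolding tr_mult tr_add tr_diff contract_ricci_riemann[OF assms(1)] contract_riemann_mid[OF assms(1)]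
    using contract_riemann_outer[OF assms(1), of s i k l]
      riemann_ricci[OF assms(1), of s i k l] riemann_ricci[OF assms(1), of s i l k]
    by (simp add: ricci_sym[OF assms(1), of _ l] ricci_sym[OF assms(1), of i k] ricci_sym[OF assms(1), of s k] mult.commute algebra_simps)
qed

text \<open>The contracted condition is summed over the rotations of \<open>s\<close>,
  \<open>i\<close>, \<open>k\<close>. On the left the terms with leading \<open>l\<close> vanish by
  Bianchi and minus the cyclic sum remains; on the right stands \<open>3 * c\<close> times the
  cyclic sum. So \<open>1 + 3 * c\<close> annihilates it.\<close>

lemma cycRicR_eq_0:
  assumes "x \<in> U"
    and pseudosym: "\<And>s i j k l m. nabla G (nabla G (riemann_low G)) x [s, i, j, k, l, m]
           - nabla G (nabla G (riemann_low G)) x [i, s, j, k, l, m] =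
           c * (Rc x j s * Rm x i k l m - Rc x j i * Rm x s k l m
            + Rc x k s * Rm x j i l m - Rc x k i * Rm x j s l m
            + Rc x l s * Rm x j k i m - Rc x l i * Rm x j k s m
            + Rc x m s * Rm x j k l i - Rc x m i * Rm x j k l s)"
    and "c \<noteq> - 1 / 3"
  shows "cycRicR x s i k l = 0"
proof -
  note contr = contracted_pseudosymmetry[OF assms(1) pseudosym]
  define S where "S s i k = RicR x s i k l - RicR x i s k l - RicR x s l i k + RicR x i l s k" for s i k
  \<comment> \<open>Antisymmetry turns the first two terms of \<open>S\<close> into two copies of
    the cyclic sum; the last two, regrouped by their leading index, give the third copy by
    Bianchi.\<close>
  have "S s i k + S i k s + S k s i = 3 * cycRicR x s i k l"
  proof -
    have *: "- RicR x a l b d + RicR x a l d b = RicR x a b d l" for a b d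
      using RicR_bianchi[OF assms(1), of a b d l] RicR_antisym[of x a d l b] by simp
    show ?thesis
      unfolding S_def cycRicR_def
      using *[of s i k] *[of i k s] *[of k s i]
        RicR_antisym[of x s k i l] RicR_antisym[of x i s k l] RicR_antisym[of x k i s l]
      by simp
  qed
  then have "c * S s i k + c * S i k s + c * S k s i = c * (3 * cycRicR x s i k l)"
    by (simp only: flip: distrib_left)
  moreover have "- RicR x l s i k - RicR x k s i l = c * S s i k"
    "- RicR x l i k s - RicR x s i k l = c * S i k s"
    "- RicR x l k s i - RicR x i k s l = c * S k s i"
    unfolding S_def using contr by blast+
  ultimately have "- (RicR x l s i k + RicR x l i k s + RicR x l k s i) - cycRicR x s i k l
      = c * (3 * cycRicR x s i k l)"
    unfolding cycRicR_def by linarith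
  then have "(1 + 3 * c) * cycRicR x s i k l = 0"
    using RicR_bianchi[OF assms(1), of l s i k] by (simp add: algebra_simps)
  then show ?thesis using assms(3) by auto
qed

end

section \<open>Weakly Z symmetric manifolds\<close>

context metric_chart
begin

text \<open>The covariant Leibniz rule for \<open>codazzi\<close>, which may be differentiated
  because it holds on the whole open set.\<close>

lemma nabla_nabla_codazzi:
  assumes "\<And>ls. length ls = 2 \<Longrightarrow> smooth_on (\<lambda>y. S y ls) U"
    and "\<And>ls. length ls = 1 \<Longrightarrow> smooth_on (\<lambda>y. w y ls) U"
    and codazzi: "\<And>y k j l. y \<in> U \<Longrightarrow>
      nabla G S y [k, j, l] - nabla G S y [j, k, l] = w y [k] * S y [j, l] - w y [j] * S y [k, l]"
    and "x \<in> U"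
  shows "nabla G (nabla G S) x [i, k, j, l] - nabla G (nabla G S) x [i, j, k, l] =
    nabla G w x [i, k] * S x [j, l] + w x [k] * nabla G S x [i, j, l]
    - nabla G w x [i, j] * S x [k, l] - w x [j] * nabla G S x [i, k, l]"
proof -
  let ?N = "nabla G S x"
  have dS: "(\<lambda>y. S y [a, b]) differentiable at x" for a b
    by (intro diff_at[OF assms(1) assms(4)]) simp
  have dw: "(\<lambda>y. w y [a]) differentiable at x" for a
    by (intro diff_at[OF assms(2) assms(4)]) simp
  have dN: "(\<lambda>y. nabla G S y [a, b, c]) differentiable at x" for a b c
    by (intro diff_at[OF smooth_nabla[of 2, OF assms(1)] assms(4)]) simp_all
  have "pd i (\<lambda>y. nabla G S y [k, j, l]) x - pd i (\<lambda>y. nabla G S y [j, k, l]) x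
      = pd i (\<lambda>y. nabla G S y [k, j, l] - nabla G S y [j, k, l]) x"
    by (rule pd_diff[symmetric]) (rule dN)+
  also have "\<dots> = pd i (\<lambda>y. w y [k] * S y [j, l] - w y [j] * S y [k, l]) x"
    by (rule pd_cong[OF open_U assms(4) codazzi])
  also have "\<dots> = w x [k] * pd i (\<lambda>y. S y [j, l]) x + pd i (\<lambda>y. w y [k]) x * S x [j, l]
      - (w x [j] * pd i (\<lambda>y. S y [k, l]) x + pd i (\<lambda>y. w y [j]) x * S x [k, l])"
    by (simp only: pd_diff pd_mult dS dw differentiable_mult)
  finally have pd: "pd i (\<lambda>y. nabla G S y [k, j, l]) x - pd i (\<lambda>y. nabla G S y [j, k, l]) x = \<dots>" .
  have split: "(\<Sum>s\<in>UNIV. c s * ?N (p s)) - (\<Sum>s\<in>UNIV. c s * ?N (q s)) = (\<Sum>s\<in>UNIV. c s * (?N (p s) - ?N (q s)))"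
    for c :: "'n \<Rightarrow> real" and p q
    by (simp only: sum_subtractf right_diff_distrib)
  \<comment> \<open>The corrections are paired by the Christoffel symbol they carry, so that each
    bracket is again a left-hand side of \<open>codazzi\<close>.\<close>
  have "nabla G (nabla G S) x [i, k, j, l] - nabla G (nabla G S) x [i, j, k, l] =
      (pd i (\<lambda>y. nabla G S y [k, j, l]) x - pd i (\<lambda>y. nabla G S y [j, k, l]) x)
      - (\<Sum>s\<in>UNIV. \<Gamma> s i k x * (?N [s, j, l] - ?N [j, s, l]))
      - (\<Sum>s\<in>UNIV. \<Gamma> s i j x * (?N [k, s, l] - ?N [s, k, l]))
      - (\<Sum>s\<in>UNIV. \<Gamma> s i l x * (?N [k, j, s] - ?N [j, k, s]))"
    unfolding split[symmetric] nabla_3[of G "nabla G S"] by argo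
  note eq = this[unfolded pd codazzi[OF assms(4)]]
  show ?thesis
    unfolding eq nabla_2 nabla_1
    by (simp add: algebra_simps sum.distrib sum_subtractf sum_distrib_left sum_distrib_right)
qed

text \<open>In the cyclic sum of \<open>nabla_nabla_codazzi\<close> the second derivatives regroup
  into three commutators, to which the Ricci identity applies. Curvature acting on the first slot of
  \<open>S\<close> drops out by Bianchi.\<close>

lemma cyclic_exterior_codazzi:
  assumes S: "\<And>ls. length ls = 2 \<Longrightarrow> smooth_on (\<lambda>y. S y ls) U"
    and w: "\<And>ls. length ls = 1 \<Longrightarrow> smooth_on (\<lambda>y. w y ls) U"
    and codazzi: "\<And>y k j l. y \<in> U \<Longrightarrow>
      nabla G S y [k, j, l] - nabla G S y [j, k, l] = w y [k] * S y [j, l] - w y [j] * S y [k, l]"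
    and x: "x \<in> U"
  shows "(nabla G w x [i, k] - nabla G w x [k, i]) * S x [j, l]
      + (nabla G w x [k, j] - nabla G w x [j, k]) * S x [i, l]
      + (nabla G w x [j, i] - nabla G w x [i, j]) * S x [k, l] =
    (\<Sum>s\<in>UNIV. Ru x i k l s * S x [j, s]) + (\<Sum>s\<in>UNIV. Ru x k j l s * S x [i, s])
      + (\<Sum>s\<in>UNIV. Ru x j i l s * S x [k, s])"
proof -
  have cod: "nabla G (nabla G S) x [i, k, j, l] - nabla G (nabla G S) x [i, j, k, l] =
    nabla G w x [i, k] * S x [j, l] + w x [k] * nabla G S x [i, j, l]
    - nabla G w x [i, j] * S x [k, l] - w x [j] * nabla G S x [i, k, l]" for i k j
    by (rule nabla_nabla_codazzi[OF assms])
  have rid: "nabla G (nabla G S) x [i, k, j, l] - nabla G (nabla G S) x [k, i, j, l] =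
    (\<Sum>s\<in>UNIV. Ru x i k j s * S x [s, l]) + (\<Sum>s\<in>UNIV. Ru x i k l s * S x [j, s])" for i k j
    by (rule ricci_identity_2[OF S x])
  \<comment> \<open>Using \<open>codazzi\<close> once more, these first-derivative terms become
    products of two components of \<open>w\<close> with \<open>S\<close>, which cancel in
    pairs.\<close>
  have "w x [k] * (nabla G S x [i, j, l] - nabla G S x [j, i, l])
      + w x [j] * (nabla G S x [k, i, l] - nabla G S x [i, k, l])
      + w x [i] * (nabla G S x [j, k, l] - nabla G S x [k, j, l]) = 0"
    unfolding codazzi[OF x] by algebra
  moreover have "(\<Sum>s\<in>UNIV. Ru x i k j s * S x [s, l]) + (\<Sum>s\<in>UNIV. Ru x k j i s * S x [s, l])
      + (\<Sum>s\<in>UNIV. Ru x j i k s * S x [s, l]) = 0"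
    unfolding sum.distrib[symmetric] distrib_right[symmetric] first_bianchi[OF x] by simp
  ultimately show ?thesis
    using cod[of i k j] cod[of k j i] cod[of j i k] rid[of i k j] rid[of k j i] rid[of j i k]
    by (simp only: left_diff_distrib right_diff_distrib)
qed

lemma riemann_Z:
  assumes "x \<in> U"
  shows "(\<Sum>s\<in>UNIV. Ru x i k l s * (Rc x j s + c * G x [j, s])) = RicR x j i k l + c * Rm x i k l j"
  by (simp add: distrib_left sum.distrib riemann_ricci[OF assms] riemann_low_eq sum_distrib_left
      metric_sym[OF assms, of j] mult_ac)

lemma nabla_sym_2:
  assumes "\<And>y a b. y \<in> U \<Longrightarrow> S y [a, b] = S y [b, a]" "x \<in> U"
  shows "nabla G S x [k, a, b] = nabla G S x [k, b, a]"
proof -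
  have "pd k (\<lambda>y. S y [a, b]) x = pd k (\<lambda>y. S y [b, a]) x"
    by (rule pd_cong[OF open_U assms(2) assms(1)])
  then show ?thesis
    unfolding nabla_2 using assms(1)[OF assms(2)] by simp
qed

text \<open>Contracting \<open>cyc\<close> over \<open>j\<close> and \<open>l\<close> with the
  inverse of \<open>S\<close> yields \<open>n\<close> copies of \<open>d i k\<close> and two of
  \<open>d k i\<close>, that is \<open>n - 2\<close> times \<open>d i k\<close>, where
  \<open>n\<close> is the dimension.\<close>

lemma nonsingular_sym_cyclic_zero:
  fixes S W :: "'n \<Rightarrow> 'n \<Rightarrow> real" and d :: "'n \<Rightarrow> 'n \<Rightarrow> real"
  assumes inv: "\<And>a b. (\<Sum>k\<in>UNIV. W k a * S k b) = (if a = b then 1 else 0)"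
    and "\<And>i k. d i k = - d k i"
    and cyc: "\<And>i k j l. d i k * S j l + d k j * S i l + d j i * S k l = 0"
    and "CARD('n) > 2"
  shows "d i k = 0"
proof -
  let ?W = "\<chi> a k. W k a" and ?S = "\<chi> k b. S k b"
  have "?W ** ?S = mat 1"
    by (simp add: matrix_matrix_mult_def mat_def vec_eq_iff inv)
  \<comment> \<open>A left inverse of a square matrix is a right inverse; the contraction below sums
    over the second index of \<open>S\<close>.\<close>
  then have "?S ** ?W = mat 1"
    by (simp add: matrix_left_right_inverse)
  then have inv': "(\<Sum>l\<in>UNIV. S k l * W j l) = (if k = j then 1 else 0)" for k j
    by (simp add: matrix_matrix_mult_def mat_def vec_eq_iff)
  have "0 = (\<Sum>j\<in>UNIV. \<Sum>l\<in>UNIV. (d i k * S j l + d k j * S i l + d j i * S k l) * W j l)"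
    unfolding cyc by simp
  also have "\<dots> = (\<Sum>j\<in>UNIV. d i k * (\<Sum>l\<in>UNIV. S j l * W j l) + d k j * (\<Sum>l\<in>UNIV. S i l * W j l)
      + d j i * (\<Sum>l\<in>UNIV. S k l * W j l))"
    by (simp add: distrib_right sum.distrib sum_distrib_left mult.assoc)
  also have "\<dots> = (real CARD('n) - 2) * d i k"
    unfolding inv' using assms(2)[of k i] by (simp add: sum.distrib algebra_simps)
  finally show ?thesis using assms(4) by auto
qed

text \<open>The whole argument in one chart: \<open>f\<close> is \<open>\<phi>\<close> in
  coordinates and \<open>c\<close> the value of the scalar at \<open>x\<close>. Pseudosymmetry
  enters pointwise at \<open>x\<close>, whereas \<open>wzs\<close> is taken on all of
  \<open>U\<close> because its consequence is differentiated.\<close>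

theorem weakly_Z_symmetric_closed:
  fixes f :: "real^'n \<Rightarrow> real" and A B D W :: "'n ltensor"
  defines "Z \<equiv> \<lambda>y ls. ricci G y ls + f y * G y ls"
  assumes "CARD('n) > 2" "x \<in> U" "smooth_on f U"
    and "\<And>k. smooth_on (\<lambda>y. A y [k]) U" "\<And>k. smooth_on (\<lambda>y. B y [k]) U"
    and wzs: "\<And>y k j l. y \<in> U \<Longrightarrow>
      nabla G Z y [k, j, l] = A y [k] * Z y [j, l] + B y [j] * Z y [k, l] + D y [l] * Z y [k, j]"
    and nonsing: "\<And>y a l. y \<in> U \<Longrightarrow> (\<Sum>k\<in>UNIV. W y [k, a] * Z y [k, l]) = (if a = l then 1 else 0)"
    and pseudosym: "\<And>s i j k l m. nabla G (nabla G (riemann_low G)) x [s, i, j, k, l, m]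
           - nabla G (nabla G (riemann_low G)) x [i, s, j, k, l, m] =
           c * (Rc x j s * Rm x i k l m - Rc x j i * Rm x s k l m
            + Rc x k s * Rm x j i l m - Rc x k i * Rm x j s l m
            + Rc x l s * Rm x j k i m - Rc x l i * Rm x j k s m
            + Rc x m s * Rm x j k l i - Rc x m i * Rm x j k l s)"
    and "c \<noteq> - 1 / 3"
  defines "w \<equiv> \<lambda>y ls. A y ls - B y ls"
  shows "nabla G w x [i, j] - nabla G w x [j, i] = 0"
proof -
  have Z_sym: "Z y [a, b] = Z y [b, a]" if "y \<in> U" for y a b
    using ricci_sym[OF that] metric_sym[OF that] by (simp add: Z_def)
  have B_eq_D: "B y [a] = D y [a]" if y: "y \<in> U" for y a
  proof -
    \<comment> \<open>Since \<open>Z\<close> is symmetric, the right-hand side of \<open>wzs\<close>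
      is unchanged when \<open>j\<close> and \<open>l\<close> are exchanged.\<close>
    have eq: "(B y [j] - D y [j]) * Z y [k, l] = (B y [l] - D y [l]) * Z y [k, j]" for k j l
    proof -
      have "nabla G Z y [k, j, l] = nabla G Z y [k, l, j]"
        by (rule nabla_sym_2[where S = Z, OF Z_sym y])
      then show ?thesis
        unfolding wzs[OF y] Z_sym[OF y, of l j] left_diff_distrib by linarith
    qed
    have "card {a} < CARD('n)" using assms(2) by simp
    then have "\<exists>b. b \<noteq> a"
      by (metis UNIV_eq_I card_seteq finite insert_iff less_irrefl singleton_iff)
    then obtain b where "b \<noteq> a" by blast
    \<comment> \<open>Contraction with the inverse at \<open>b\<close> isolates \<open>B - D\<close>
      at \<open>a\<close> on one side; the other side vanishes because \<open>b\<close> differs from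
      \<open>a\<close>.\<close>
    have "(\<Sum>k\<in>UNIV. W y [k, b] * ((B y [a] - D y [a]) * Z y [k, b]))
        = (\<Sum>k\<in>UNIV. W y [k, b] * ((B y [b] - D y [b]) * Z y [k, a]))"
      unfolding eq[of a _ b] ..
    then have "(B y [a] - D y [a]) * (\<Sum>k\<in>UNIV. W y [k, b] * Z y [k, b])
        = (B y [b] - D y [b]) * (\<Sum>k\<in>UNIV. W y [k, b] * Z y [k, a])"
      by (simp add: sum_distrib_left mult_ac)
    then show ?thesis
      unfolding nonsing[OF y] using \<open>b \<noteq> a\<close> by simp
  qed
  \<comment> \<open>The \<open>D\<close> terms cancel by symmetry of \<open>Z\<close>, and the
    \<open>A\<close> and \<open>B\<close> terms regroup into \<open>w\<close>.\<close>
  have codazzi: "nabla G Z y [k, j, l] - nabla G Z y [j, k, l] = w y [k] * Z y [j, l] - w y [j] * Z y [k, l]"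
    if y: "y \<in> U" for y k j l
    unfolding wzs[OF y] w_def using Z_sym[OF y, of k j] B_eq_D[OF y] by (simp add: algebra_simps)
  have smooth_Z: "smooth_on (\<lambda>y. Z y ls) U" if "length ls = 2" for ls
  proof -
    obtain a b where "ls = [a, b]"
      using \<open>length ls = 2\<close> by (auto simp: length_Suc_conv numeral_2_eq_2)
    then show ?thesis
      unfolding Z_def by (auto intro!: smooth_on_add smooth_on_mult open_U smooth_ricci assms smooth_metric)
  qed
  have smooth_w: "smooth_on (\<lambda>y. w y ls) U" if "length ls = 1" for ls
  proof -
    obtain a where "ls = [a]"
      using \<open>length ls = 1\<close> by (auto simp: length_Suc_conv)
    then show ?thesis
      unfolding w_def by (auto intro!: smooth_on_diff open_U assms)
  qed
  let ?d = "\<lambda>i k. nabla G w x [i, k] - nabla G w x [k, i]"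
  have "?d i k * Z x [j, l] + ?d k j * Z x [i, l] + ?d j i * Z x [k, l] = 0" for i k j l
  proof -
    have RZ: "(\<Sum>s\<in>UNIV. Ru x a b e s * Z x [m, s]) = RicR x m a b e + f x * Rm x a b e m" for a b e m
      by (simp add: Z_def riemann_Z[OF assms(3)])
    have "?d i k * Z x [j, l] + ?d k j * Z x [i, l] + ?d j i * Z x [k, l]
      = (\<Sum>s\<in>UNIV. Ru x i k l s * Z x [j, s]) + (\<Sum>s\<in>UNIV. Ru x k j l s * Z x [i, s])
      + (\<Sum>s\<in>UNIV. Ru x j i l s * Z x [k, s])"
      by (rule cyclic_exterior_codazzi[OF smooth_Z smooth_w codazzi assms(3)])
    also have "\<dots> = cycRicR x j i k l + f x * (Rm x i k l j + Rm x k j l i + Rm x j i l k)"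
      unfolding RZ cycRicR_def distrib_left by linarith
    finally have "?d i k * Z x [j, l] + ?d k j * Z x [i, l] + ?d j i * Z x [k, l] = \<dots>" .
    \<comment> \<open>Thus the part of \<open>Z\<close> proportional to the metric, and with it
      \<open>f\<close>, contributes nothing to the obstruction.\<close>
    moreover have "Rm x i k l j + Rm x k j l i + Rm x j i l k = 0"
      using Rm_bianchi[OF assms(3), of i k j l] Rm_antisym34[OF assms(3), of i k l j]
        Rm_antisym34[OF assms(3), of k j l i] Rm_antisym34[OF assms(3), of j i l k] by simp
    ultimately show ?thesis
      using cycRicR_eq_0[OF assms(3) pseudosym assms(10)] by simp
  qed
  then show ?thesis
    by (intro nonsingular_sym_cyclic_zero[where d = ?d and W = "\<lambda>a b. W x [a, b]" and S = "\<lambda>a b. Z x [a, b]"])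
      (use nonsing[OF assms(3)] assms(2) in auto)
qed

end

section \<open>From the manifold to a single chart\<close>

lemma riemannian_metric_chart:
  assumes "riemannian_manifold X \<A> g" "c \<in> \<A>"
  shows "metric_chart (img_chart c) (g c)"
proof
  show "open (img_chart c)"
    using assms by (auto simp: riemannian_manifold_def smooth_manifold_def)
  show "smooth_on (\<lambda>x. g c x [i, j]) (img_chart c)" for i j
    using assms by (auto simp: riemannian_manifold_def covariant_tensor_def smooth_components_def)
  fix x assume x: "x \<in> img_chart c"
  show "g c x [i, j] = g c x [j, i]" for i j
    using assms x by (auto simp: riemannian_manifold_def)
  let ?M = "\<chi> i j. g c x [i, j]"
  \<comment> \<open>On a kernel vector the quadratic form vanishes, so positive definiteness makes
    the kernel trivial.\<close>
  have "v = 0" if "?M *v v = 0" for v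
  proof (rule ccontr)
    assume "v \<noteq> 0"
    then have "0 < (\<Sum>i\<in>UNIV. \<Sum>j\<in>UNIV. g c x [i, j] * v $ i * v $ j)"
      using assms x by (auto simp: riemannian_manifold_def)
    also have "\<dots> = (\<Sum>i\<in>UNIV. v $ i * (?M *v v) $ i)"
      by (simp add: matrix_vector_mult_def sum_distrib_left mult_ac)
    finally show False using that by simp
  qed
  then show "invertible ?M"
    by (simp add: invertible_left_inverse matrix_left_invertible_ker)
qed

theorem proposition4p18:
  fixes X :: "'a topology"
    and \<A> :: "('a, 'n::finite) chart set"
    and g A B D :: "('a, 'n) tensor"
    and \<phi> L :: "'a \<Rightarrow> real"
  assumes "CARD('n) > 3"
    and "riemannian_manifold X \<A> g"
    and "weakly_Z_symmetric \<A> g \<phi> A B D"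
    and "generalized_Ricci_pseudosymmetric X \<A> g L"
    and "Z_nonsingular \<A> g \<phi>"
    and "\<forall>p\<in>topspace X. L p \<noteq> - 1 / 3"
  shows "closed_form \<A> g (\<lambda>c x is. A c x is - B c x is)"
  unfolding closed_form_def
proof (intro ballI allI)
  fix c x i j
  assume c: "c \<in> \<A>" and x: "x \<in> img_chart c"
  interpret metric_chart "img_chart c" "g c"
    by (rule riemannian_metric_chart[OF assms(2) c])
  have Z: "Z_tensor g \<phi> c = (\<lambda>y ls. ricci (g c) y ls + \<phi> (inv_coord c y) * g c y ls)"
    by (simp add: Z_tensor_def fun_eq_iff)
  obtain W where W: "\<forall>c\<in>\<A>. \<forall>x\<in>img_chart c. \<forall>h l.
      (\<Sum>k\<in>UNIV. W c x [k, h] * Z_tensor g \<phi> c x [k, l]) = (if h = l then 1 else 0)"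
    using assms(5) unfolding Z_nonsingular_def by blast
  \<comment> \<open>The bound on \<open>L\<close> is stated at points of the manifold, so the
    coordinate vector \<open>x\<close> is carried back through the chart.\<close>
  have "inv_coord c x \<in> dom_chart c"
    using x unfolding img_chart_def inv_coord_def by (rule inv_into_into)
  then have "inv_coord c x \<in> topspace X"
    using assms(2) c unfolding riemannian_manifold_def smooth_manifold_def by blast
  then have L: "L (inv_coord c x) \<noteq> - 1 / 3"
    using assms(6) by blast
  have smooth: "smooth_on (\<lambda>y. \<phi> (inv_coord c y)) (img_chart c)"
    "\<And>k. smooth_on (\<lambda>y. A c y [k]) (img_chart c)" "\<And>k. smooth_on (\<lambda>y. B c y [k]) (img_chart c)"
    using assms(3) c
    by (simp_all add: weakly_Z_symmetric_def smooth_scalar_def covariant_tensor_def smooth_components_def)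
  have wzs: "nabla (g c) (Z_tensor g \<phi> c) y [k, j, l] = A c y [k] * Z_tensor g \<phi> c y [j, l]
      + B c y [j] * Z_tensor g \<phi> c y [k, l] + D c y [l] * Z_tensor g \<phi> c y [k, j]"
    if "y \<in> img_chart c" for y k j l
    using assms(3) c that unfolding weakly_Z_symmetric_def Let_def by blast
  have pseudosym: "nabla (g c) (nabla (g c) (riemann_low (g c))) x [s, i, j, k, l, m]
      - nabla (g c) (nabla (g c) (riemann_low (g c))) x [i, s, j, k, l, m] =
      L (inv_coord c x) *
       (Rc x j s * Rm x i k l m - Rc x j i * Rm x s k l m
      + Rc x k s * Rm x j i l m - Rc x k i * Rm x j s l m
      + Rc x l s * Rm x j k i m - Rc x l i * Rm x j k s m
      + Rc x m s * Rm x j k l i - Rc x m i * Rm x j k l s)" for s i j k l m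
    using assms(4) c x unfolding generalized_Ricci_pseudosymmetric_def Let_def by blast
  have "CARD('n) > 2" using assms(1) by simp
  then show "nabla (g c) (\<lambda>x is. A c x is - B c x is) x [i, j] - nabla (g c) (\<lambda>x is. A c x is - B c x is) x [j, i] = 0"
    by (rule weakly_Z_symmetric_closed[OF _ x smooth wzs[unfolded Z] W[rule_format, OF c, unfolded Z] pseudosym L])
qed

end
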